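(* Let $(W,S)$ be an irreducible finite Coxeter system with Coxeter number $h$, $c$ a Coxeter element with reduced word $\mathbf{c}$, $k\geq0$, and $Q=\mathbf{c}^k\mathbf{w}_\circ(\mathbf{c})$. Then the order of the permutation $\Theta$ of the positions of $Q$ is $k+h/2$ if $w_\circ=-\mathbf{1}$ (i.e. $w_\circ$ acts as $-\mathrm{Id}$ on the reflection representation), and $2k+h$ otherwise.
   Context: $h$ is the order of any Coxeter element. $w_\circ$ is the longest element, $\psi(s)=w_\circ^{-1}sw_\circ$. $\mathbf{w}_\circ(\mathbf{c})$ is the lexicographically first (as a sequence of positions) subword of $\mathbf{c}\mathbf{c}\cdots$ which is a reduced expression for $w_\circ$. For $Q=(q_1,\dots,q_r)$, the map $\Theta$ on positions sends a position $i$ with $q_i=s$ to the next position $j>i$ with $q_j=s$ if one exists, and otherwise to the first position $j$ with $q_j=\psi(s)$. *)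

theory Defs
  imports Complex_Main "HOL-Algebra.Multiplicative_Group" "HOL-Algebra.Generated_Groups"
    "HOL-Algebra.Sym_Groups"
begin

definition word_prod :: "('a, 'b) monoid_scheme \<Rightarrow> 'a list \<Rightarrow> 'a" where
  "word_prod W ws = foldr (\<otimes>\<^bsub>W\<^esub>) ws \<one>\<^bsub>W\<^esub>"

text \<open>The order \<open>m(s,t)\<close> of \<open>st\<close>; the library convention \<open>group.ord = 0\<close> encodes infinite order.\<close>

definition coxeter_m :: "('a, 'b) monoid_scheme \<Rightarrow> 'a \<Rightarrow> 'a \<Rightarrow> nat" where
  "coxeter_m W s t = group.ord W (s \<otimes>\<^bsub>W\<^esub> t)"

text \<open>Insertion of a relator \<open>(st)\<^bsup>m(s,t)\<^esup>\<close> into a word over \<open>S\<close>. For \<open>m(s,t) = \<infinity>\<close> the inserted word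
  is empty, so no relation is imposed.\<close>

definition relator_insertion :: "('a, 'b) monoid_scheme \<Rightarrow> 'a set \<Rightarrow> ('a list \<times> 'a list) set" where
  "relator_insertion W S =
     {(us @ vs, us @ concat (replicate (coxeter_m W s t) [s, t]) @ vs) | us vs s t.
        us \<in> lists S \<and> vs \<in> lists S \<and> s \<in> S \<and> t \<in> S}"

text \<open>The assumption \<open>presentation\<close> says that \<open>W\<close> is presented by the generators \<open>S\<close> and the
  relations \<open>(st)\<^bsup>m(s,t)\<^esup> = 1\<close>. Words without inverse letters suffice, because the relators
  \<open>(ss)\<^bsup>m(s,s)\<^esup> = ss\<close> make every generator its own inverse.\<close>

locale coxeter_system = group W for W :: "('a, 'b) monoid_scheme" (structure) +
  fixes S :: "'a set"
  assumes generators: "S \<subseteq> carrier W" "generate W S = carrier W"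
    and generators_order: "\<And>s. s \<in> S \<Longrightarrow> ord s = 2"
    and presentation: "\<And>us vs. us \<in> lists S \<Longrightarrow> vs \<in> lists S \<Longrightarrow> word_prod W us = word_prod W vs \<Longrightarrow>
          (us, vs) \<in> (relator_insertion W S \<union> (relator_insertion W S)\<inverse>)\<^sup>*"

text \<open>The Coxeter graph joins \<open>s \<noteq> t\<close> when \<open>m(s,t) \<ge> 3\<close>, including \<open>m(s,t) = \<infinity>\<close>, that is, when
  \<open>m(s,t) \<noteq> 2\<close>.\<close>

definition coxeter_graph :: "('a, 'b) monoid_scheme \<Rightarrow> 'a set \<Rightarrow> ('a \<times> 'a) set" where
  "coxeter_graph W S = {(s, t). s \<in> S \<and> t \<in> S \<and> s \<noteq> t \<and> coxeter_m W s t \<noteq> 2}"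

definition coxeter_irreducible :: "('a, 'b) monoid_scheme \<Rightarrow> 'a set \<Rightarrow> bool" where
  "coxeter_irreducible W S \<longleftrightarrow> S \<noteq> {} \<and> (\<forall>s\<in>S. \<forall>t\<in>S. (s, t) \<in> (coxeter_graph W S)\<^sup>*)"

definition coxeter_length :: "('a, 'b) monoid_scheme \<Rightarrow> 'a set \<Rightarrow> 'a \<Rightarrow> nat" where
  "coxeter_length W S w = (LEAST n. \<exists>ws\<in>lists S. word_prod W ws = w \<and> length ws = n)"

definition reduced_word :: "('a, 'b) monoid_scheme \<Rightarrow> 'a set \<Rightarrow> 'a \<Rightarrow> 'a list \<Rightarrow> bool" where
  "reduced_word W S w ws \<longleftrightarrow>
     ws \<in> lists S \<and> word_prod W ws = w \<and> length ws = coxeter_length W S w"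

definition longest_element :: "('a, 'b) monoid_scheme \<Rightarrow> 'a set \<Rightarrow> 'a" where
  "longest_element W S =
     (THE w. w \<in> carrier W \<and> (\<forall>v\<in>carrier W. coxeter_length W S v \<le> coxeter_length W S w))"

definition coxeter_psi :: "('a, 'b) monoid_scheme \<Rightarrow> 'a set \<Rightarrow> 'a \<Rightarrow> 'a" where
  "coxeter_psi W S s = inv\<^bsub>W\<^esub> (longest_element W S) \<otimes>\<^bsub>W\<^esub> s \<otimes>\<^bsub>W\<^esub> longest_element W S"

definition coxeter_element :: "('a, 'b) monoid_scheme \<Rightarrow> 'a set \<Rightarrow> 'a \<Rightarrow> bool" where
  "coxeter_element W S c \<longleftrightarrow> (\<exists>ws. distinct ws \<and> set ws = S \<and> word_prod W ws = c)"

definition coxeter_number :: "('a, 'b) monoid_scheme \<Rightarrow> 'a set \<Rightarrow> nat" where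
  "coxeter_number W S = (THE h. \<forall>c. coxeter_element W S c \<longrightarrow> group.ord W c = h)"

text \<open>Letters of the infinite word \<open>cs cs \<dots>\<close> at the positions \<open>ps\<close>, counted from \<open>0\<close>.\<close>

definition periodic_subword :: "'a list \<Rightarrow> nat list \<Rightarrow> 'a list" where
  "periodic_subword cs ps = map (\<lambda>p. cs ! (p mod length cs)) ps"

definition longest_positions :: "('a, 'b) monoid_scheme \<Rightarrow> 'a set \<Rightarrow> 'a list \<Rightarrow> nat list \<Rightarrow> bool" where
  "longest_positions W S cs ps \<longleftrightarrow>
     sorted_wrt (<) ps \<and> reduced_word W S (longest_element W S) (periodic_subword cs ps)"

definition longest_sorting_word :: "('a, 'b) monoid_scheme \<Rightarrow> 'a set \<Rightarrow> 'a list \<Rightarrow> 'a list" where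
  "longest_sorting_word W S cs = periodic_subword cs
     (THE ps. longest_positions W S cs ps \<and>
        (\<forall>qs. longest_positions W S cs qs \<longrightarrow> ps = qs \<or> (ps, qs) \<in> lexord less_than))"

text \<open>The positions of \<open>Q\<close> are \<open>1, \<dots>, length Q\<close>, the letter at position \<open>i\<close> being \<open>Q ! (i - 1)\<close>;
  the map is extended by the identity to all of \<open>nat\<close>, as required by \<^const>\<open>sym_group\<close>.\<close>

definition rotation_map :: "('a \<Rightarrow> 'a) \<Rightarrow> 'a list \<Rightarrow> nat \<Rightarrow> nat" where
  "rotation_map \<psi> Q i =
     (if i \<notin> {1..length Q} then i
      else if \<exists>j\<in>{1..length Q}. i < j \<and> Q ! (j - 1) = Q ! (i - 1)
      then (LEAST j. j \<in> {1..length Q} \<and> i < j \<and> Q ! (j - 1) = Q ! (i - 1))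
      else (LEAST j. j \<in> {1..length Q} \<and> Q ! (j - 1) = \<psi> (Q ! (i - 1))))"

text \<open>The reflection representation acts on the real vector space with basis the simple roots
  \<open>\<alpha>\<^sub>s\<close>, \<open>s \<in> S\<close>. A vector is given by its coordinate function, which vanishes outside \<open>S\<close> (for
  finite \<open>S\<close>). For \<open>m(s,t) = \<infinity>\<close>, encoded as \<open>0\<close>, division by zero gives the usual value \<open>-1\<close>
  of the form.\<close>

definition reflection_space :: "'a set \<Rightarrow> ('a \<Rightarrow> real) set" where
  "reflection_space S = {v. \<forall>x. x \<notin> S \<longrightarrow> v x = 0}"

definition simple_root :: "'a \<Rightarrow> 'a \<Rightarrow> real" where
  "simple_root s = (\<lambda>x. if x = s then 1 else 0)"

definition coxeter_form ::
    "('a, 'b) monoid_scheme \<Rightarrow> 'a set \<Rightarrow> ('a \<Rightarrow> real) \<Rightarrow> ('a \<Rightarrow> real) \<Rightarrow> real" where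
  "coxeter_form W S u v = (\<Sum>s\<in>S. \<Sum>t\<in>S. u s * v t * (- cos (pi / real (coxeter_m W s t))))"

definition simple_reflection ::
    "('a, 'b) monoid_scheme \<Rightarrow> 'a set \<Rightarrow> 'a \<Rightarrow> ('a \<Rightarrow> real) \<Rightarrow> ('a \<Rightarrow> real)" where
  "simple_reflection W S s v = (\<lambda>x. v x - 2 * coxeter_form W S (simple_root s) v * simple_root s x)"

text \<open>The representation is the multiplicative extension of \<open>s \<mapsto> simple_reflection W S s\<close>: the image
  of \<open>v\<close> under \<open>w\<close> is the common value obtained from all words for \<open>w\<close>.\<close>

definition reflection_rep ::
    "('a, 'b) monoid_scheme \<Rightarrow> 'a set \<Rightarrow> 'a \<Rightarrow> ('a \<Rightarrow> real) \<Rightarrow> ('a \<Rightarrow> real)" where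
  "reflection_rep W S w v =
     (THE u. \<forall>ws\<in>lists S. word_prod W ws = w \<longrightarrow> foldr (simple_reflection W S) ws v = u)"

definition acts_as_minus_one :: "('a, 'b) monoid_scheme \<Rightarrow> 'a set \<Rightarrow> 'a \<Rightarrow> bool" where
  "acts_as_minus_one W S w \<longleftrightarrow>
     (\<forall>v\<in>reflection_space S. reflection_rep W S w v = (\<lambda>x. - v x))"

end

theory Submission
  imports Defs
begin

text \<open>
  Write \<open>c = s\<^sub>1 \<dots> s\<^sub>n\<close> and let \<open>P\<^sub>j = s\<^sub>1 \<dots> s\<^bsub>j-1\<^esub> \<alpha>\<^sub>j\<close> be the inversions of \<open>c\<close>. Every positive root is
  \<open>c\<^sup>i P\<^sub>s\<close> for a unique \<open>s\<close> and \<open>i < a\<^sub>s\<close>, where \<open>a\<^sub>s\<close> is the first \<open>i\<close> for which \<open>c\<^sup>i P\<^sub>s\<close> is negative; at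
  \<open>i = a\<^sub>s\<close> this root is \<open>- P\<^sub>t\<close> for some \<open>t\<close>. Positivity of the \<open>c\<close>-invariant Euler form on neighbouring roots shows that
  \<open>a\<^sub>t \<le> a\<^sub>s \<le> a\<^sub>t + 1\<close> when \<open>s\<close> and \<open>t\<close> are joined and \<open>s\<close> precedes \<open>t\<close> in \<open>c\<close>. Hence the letters of
  \<open>c c \<dots>\<close> other than the first \<open>a\<^sub>s\<close> copies of each \<open>s\<close> can be commuted out to the right, those copies spell
  the sorting word of \<open>w\<^sub>0\<close>, and \<open>t = \<psi> s\<close>. The same Euler form argument shows that
  \<open>a\<^sub>s + a\<^bsub>\<psi> s\<^esub>\<close> is constant along the Coxeter graph, and this constant is the order \<open>h\<close> of \<open>c\<close>. The cycle of
  \<open>\<Theta>\<close> through the letters \<open>s\<close> therefore has length \<open>2k + h\<close> if \<open>\<psi> s \<noteq> s\<close> and \<open>k + h/2\<close> if \<open>\<psi> s = s\<close>.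
\<close>

section \<open>Words and length\<close>

text \<open>The presentation gives no direct grip on lengths, so everything is read off from signs
  of roots: Tits' theorem (\<open>ascent_root_nonneg\<close>) turns each comparison of lengths into
  a sign question, and \<open>root_nonnegI\<close> settles the sign of a root by one coordinate.
  This is what the Euler form provides beyond the symmetric form \<open>B\<close>:
  \<open>euler (proj s) v\<close> is a coordinate of \<open>v\<close>. A positive value of the form
  is transported along powers of \<open>c\<close> to the exponent at which the first argument has
  turned into some \<open>- proj t\<close>; the second root then has a negative coordinate, hence is
  negative. A further obstacle is that \<open>coxeter_number\<close> speaks of all Coxeter elements
  at once, while the argument fixes one word. Summing \<open>num s + num (\<psi> s) = ord c\<close>
  over \<open>S\<close> counts the sorting word twice and gives
  \<open>card S * ord c = 2 * len w\<^sub>0\<close>, whose right side does not see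
  \<open>c\<close>.\<close>

context coxeter_system
begin

abbreviation "wp \<equiv> word_prod W"
abbreviation "len \<equiv> coxeter_length W S"

lemma word_prod_Nil [simp]: "wp [] = \<one>"
  by (simp add: word_prod_def)

lemma word_prod_Cons [simp]: "wp (s # ws) = s \<otimes> wp ws"
  by (simp add: word_prod_def)

lemma generator_closed [simp, intro]: "s \<in> S \<Longrightarrow> s \<in> carrier W"
  using generators by auto

lemma word_prod_closed [simp, intro]: "ws \<in> lists S \<Longrightarrow> wp ws \<in> carrier W"
  by (induction ws) auto

lemma word_prod_append:
  "us \<in> lists S \<Longrightarrow> vs \<in> lists S \<Longrightarrow> wp (us @ vs) = wp us \<otimes> wp vs"
  by (induction us) (auto simp: m_assoc)

lemma generator_square [simp]: "s \<in> S \<Longrightarrow> s \<otimes> s = \<one>"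
  using generators_order[of s] pow_ord_eq_1[of s] by (simp add: numeral_2_eq_2)

lemma generator_inv [simp]: "s \<in> S \<Longrightarrow> inv s = s"
  by (simp add: inv_equality)

lemma generator_cancel [simp]:
  "s \<in> S \<Longrightarrow> w \<in> carrier W \<Longrightarrow> s \<otimes> (s \<otimes> w) = w"
  "s \<in> S \<Longrightarrow> w \<in> carrier W \<Longrightarrow> w \<otimes> s \<otimes> s = w"
  by (simp_all add: m_assoc flip: m_assoc[of s s w])

lemma word_prod_rev: "ws \<in> lists S \<Longrightarrow> wp (rev ws) = inv (wp ws)"
proof (induction ws)
  case (Cons s ws)
  then show ?case
    using word_prod_append[of "rev ws" "[s]"] by (auto simp: inv_mult_group in_lists_conv_set)
qed simp

lemma word_exists: "w \<in> carrier W \<Longrightarrow> \<exists>ws\<in>lists S. wp ws = w"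
proof -
  assume "w \<in> carrier W"
  then have "w \<in> generate W S" using generators by simp
  then show ?thesis
  proof induction
    case one then show ?case by (auto intro: bexI[of _ "[]"])
  next
    case (incl h) then show ?case by (auto intro!: bexI[of _ "[h]"])
  next
    case (inv h) then show ?case by (auto intro!: bexI[of _ "[h]"])
  next
    case (eng h1 h2)
    then obtain u v where "u \<in> lists S" "v \<in> lists S" "wp u = h1" "wp v = h2" by blast
    then show ?case using word_prod_append[of u v] by (intro bexI[of _ "u @ v"]) auto
  qed
qed

lemma length_word_ge: "ws \<in> lists S \<Longrightarrow> len (wp ws) \<le> length ws"
  unfolding coxeter_length_def by (rule Least_le) auto

lemma reduced_word_exists:
  assumes "w \<in> carrier W"
  obtains ws where "ws \<in> lists S" "wp ws = w" "length ws = len w"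
proof -
  from word_exists[OF assms] have "\<exists>n. \<exists>ws\<in>lists S. wp ws = w \<and> length ws = n" by blast
  from LeastI_ex[OF this] show ?thesis
    using that unfolding coxeter_length_def by blast
qed

lemma length_one [simp]: "len \<one> = 0"
  using length_word_ge[of "[]"] by simp

lemma length_zero_iff: "w \<in> carrier W \<Longrightarrow> len w = 0 \<longleftrightarrow> w = \<one>"
  by (metis length_one length_0_conv reduced_word_exists word_prod_Nil)

lemma length_mult_le:
  assumes "u \<in> carrier W" "v \<in> carrier W"
  shows "len (u \<otimes> v) \<le> len u + len v"
proof -
  obtain us vs where "us \<in> lists S" "wp us = u" "length us = len u"
    "vs \<in> lists S" "wp vs = v" "length vs = len v"
    using assms reduced_word_exists by metis
  then show ?thesis
    using length_word_ge[of "us @ vs"] word_prod_append[of us vs] by auto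
qed

lemma length_inv_le: "w \<in> carrier W \<Longrightarrow> len (inv w) \<le> len w"
  by (metis in_lists_conv_set length_rev length_word_ge reduced_word_exists set_rev word_prod_rev)

lemma length_inv: "w \<in> carrier W \<Longrightarrow> len (inv w) = len w"
  using length_inv_le[of w] length_inv_le[of "inv w"] by auto

lemma length_generator_le: "s \<in> S \<Longrightarrow> len s \<le> 1"
  using length_word_ge[of "[s]"] by simp

lemma length_mult_generator_le:
  assumes "w \<in> carrier W" "s \<in> S"
  shows "len (w \<otimes> s) \<le> Suc (len w)" "len w \<le> Suc (len (w \<otimes> s))"
  using length_mult_le[of w s] length_mult_le[of "w \<otimes> s" s] length_generator_le[of s] assms by auto

text \<open>Relators have the even length \<open>2 * coxeter_m W s t\<close>, so inserting or
  deleting one preserves parity. Consequently multiplication by a generator always changes the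
  length.\<close>

lemma length_parity:
  assumes "us \<in> lists S" "vs \<in> lists S" "wp us = wp vs"
  shows "even (length us) \<longleftrightarrow> even (length vs)"
proof -
  have "(us, vs) \<in> (relator_insertion W S \<union> (relator_insertion W S)\<inverse>)\<^sup>*"
    using presentation assms by blast
  then show ?thesis
  proof induction
    case (step y z)
    have "length (concat (replicate n [s, t])) = 2 * n" for n and s t :: 'a
      by (induction n) auto
    with step show ?case by (auto simp: relator_insertion_def)
  qed simp
qed

lemma length_mult_generator_neq:
  assumes "w \<in> carrier W" "s \<in> S"
  shows "len (w \<otimes> s) \<noteq> len w"
proof
  assume eq: "len (w \<otimes> s) = len w"
  obtain us vs where "us \<in> lists S" "wp us = w" "length us = len w"
    "vs \<in> lists S" "wp vs = w \<otimes> s" "length vs = len (w \<otimes> s)"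
    using assms reduced_word_exists by (metis m_closed generator_closed)
  then show False
    using length_parity[of "us @ [s]" vs] word_prod_append[of us "[s]"] eq assms by auto
qed

lemma length_mult_generator_cases:
  assumes "w \<in> carrier W" "s \<in> S"
  obtains "len (w \<otimes> s) = Suc (len w)" | "len w = Suc (len (w \<otimes> s))"
  using length_mult_generator_le[OF assms] length_mult_generator_neq[OF assms] by linarith

lemma length_generator: "s \<in> S \<Longrightarrow> len s = 1"
  using length_mult_generator_neq[of "\<one>" s] length_generator_le[of s] by simp

lemma descent_exists:
  assumes "w \<in> carrier W" "w \<noteq> \<one>"
  obtains t where "t \<in> S" "len w = Suc (len (w \<otimes> t))"
proof -
  obtain ws where ws: "ws \<in> lists S" "wp ws = w" "length ws = len w"
    using assms reduced_word_exists by metis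
  then have "ws \<noteq> []" using assms by auto
  then obtain us t where us: "ws = us @ [t]" by (metis rev_exhaust)
  then have t: "t \<in> S" "us \<in> lists S" using ws by auto
  then have "w = wp us \<otimes> t" using ws us word_prod_append[of us "[t]"] by auto
  then have "w \<otimes> t = wp us" using t generator_cancel(2) word_prod_closed by blast
  then have "len (w \<otimes> t) \<le> length us" using length_word_ge t by simp
  then show ?thesis
    using that t ws us length_mult_generator_le(2)[OF assms(1) t(1)] by simp
qed

lemma coxeter_m_commute:
  assumes "s \<in> S" "t \<in> S"
  shows "coxeter_m W s t = coxeter_m W t s"
  using ord_inv[of "s \<otimes> t"] assms by (simp add: coxeter_m_def inv_mult_group)

lemma coxeter_m_same [simp]: "s \<in> S \<Longrightarrow> coxeter_m W s s = 1"
  by (simp add: coxeter_m_def)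

lemma coxeter_m_neq_one:
  assumes "s \<in> S" "t \<in> S" "s \<noteq> t"
  shows "coxeter_m W s t \<noteq> 1"
proof
  assume "coxeter_m W s t = 1"
  then have "s \<otimes> t = \<one>"
    using assms pow_ord_eq_1[of "s \<otimes> t"] by (simp add: coxeter_m_def)
  then have "inv t = s" using assms by (intro inv_equality) auto
  then show False using assms by simp
qed

lemma coxeter_m_two_commute:
  assumes "s \<in> S" "t \<in> S" "coxeter_m W s t = 2"
  shows "s \<otimes> t = t \<otimes> s"
proof -
  have "(s \<otimes> t) \<otimes> (s \<otimes> t) = \<one>"
    using assms pow_ord_eq_1[of "s \<otimes> t"] by (simp add: coxeter_m_def numeral_2_eq_2)
  then have "s \<otimes> t = inv (s \<otimes> t)" using assms by (simp add: inv_equality)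
  then show ?thesis using assms by (simp add: inv_mult_group)
qed

end

section \<open>The reflection representation\<close>

locale finite_coxeter_system = coxeter_system +
  assumes finite_carrier: "finite (carrier W)"
begin

abbreviation "B \<equiv> coxeter_form W S"
abbreviation "\<alpha> \<equiv> simple_root"
abbreviation "\<sigma> \<equiv> simple_reflection W S"
abbreviation "\<rho> \<equiv> reflection_rep W S"

lemma finite_generators [simp]: "finite S"
  using generators(1) finite_carrier by (rule finite_subset)

lemma coxeter_m_pos: "s \<in> S \<Longrightarrow> t \<in> S \<Longrightarrow> coxeter_m W s t \<ge> 1"
  unfolding coxeter_m_def using ord_ge_1[OF finite_carrier, of "s \<otimes> t"] by simp

lemma coxeter_m_ge_two: "s \<in> S \<Longrightarrow> t \<in> S \<Longrightarrow> s \<noteq> t \<Longrightarrow> coxeter_m W s t \<ge> 2"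
  using coxeter_m_pos[of s t] coxeter_m_neq_one[of s t] by linarith

lemma form_linear_right: "B u (\<lambda>x. a * v x + b * w x) = a * B u v + b * B u w"
  unfolding coxeter_form_def sum_distrib_left sum.distrib[symmetric]
  by (intro sum.cong refl) (simp add: algebra_simps)

lemma form_commute: "B u v = B v u"
  unfolding coxeter_form_def
  by (subst sum.swap) (auto intro!: sum.cong simp: coxeter_m_commute)

lemma form_linear_left: "B (\<lambda>x. a * v x + b * w x) u = a * B v u + b * B w u"
  using form_linear_right[of u a v b w] by (simp add: form_commute)

lemma form_simple_root:
  assumes "s \<in> S"
  shows "B (\<alpha> s) v = (\<Sum>t\<in>S. v t * (- cos (pi / real (coxeter_m W s t))))"
proof -
  have "B (\<alpha> s) v = (\<Sum>r\<in>S. if r = s then \<Sum>t\<in>S. v t * (- cos (pi / real (coxeter_m W r t))) else 0)"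
    unfolding coxeter_form_def simple_root_def by (rule sum.cong) auto
  then show ?thesis using assms by simp
qed

lemma form_simple_roots:
  assumes "s \<in> S" "t \<in> S"
  shows "B (\<alpha> s) (\<alpha> t) = - cos (pi / real (coxeter_m W s t))"
proof -
  have "B (\<alpha> s) (\<alpha> t) = (\<Sum>r\<in>S. if r = t then - cos (pi / real (coxeter_m W s r)) else 0)"
    unfolding form_simple_root[OF assms(1)] by (rule sum.cong) (simp_all add: simple_root_def)
  then show ?thesis using assms by simp
qed

lemma form_simple_root_same [simp]: "s \<in> S \<Longrightarrow> B (\<alpha> s) (\<alpha> s) = 1"
  by (simp add: form_simple_roots)

lemma form_simple_roots_nonpos:
  assumes "s \<in> S" "t \<in> S" "s \<noteq> t"
  shows "B (\<alpha> s) (\<alpha> t) \<le> 0"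
proof -
  have "cos (pi / real (coxeter_m W s t)) \<ge> 0"
  proof (rule cos_ge_zero)
    have "0 \<le> pi / real (coxeter_m W s t)" by simp
    then show "- (pi / 2) \<le> pi / real (coxeter_m W s t)" using pi_gt_zero by linarith
    show "pi / real (coxeter_m W s t) \<le> pi / 2"
      using coxeter_m_ge_two[OF assms] by (intro divide_left_mono) auto
  qed
  then show ?thesis by (simp add: form_simple_roots assms)
qed

lemma form_simple_roots_neg:
  assumes "s \<in> S" "t \<in> S" "s \<noteq> t" "coxeter_m W s t \<noteq> 2"
  shows "B (\<alpha> s) (\<alpha> t) < 0"
proof -
  have "coxeter_m W s t > 2" using coxeter_m_ge_two[of s t] assms by simp
  then have "cos (pi / real (coxeter_m W s t)) > 0"
    by (intro cos_gt_zero) (auto simp: field_simps)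
  then show ?thesis by (simp add: form_simple_roots assms)
qed

lemma form_simple_roots_zero:
  assumes "s \<in> S" "t \<in> S" "coxeter_m W s t = 2"
  shows "B (\<alpha> s) (\<alpha> t) = 0"
  by (simp add: form_simple_roots assms)

lemma reflection_alt: "\<sigma> s v = (\<lambda>x. 1 * v x + (- 2 * B (\<alpha> s) v) * \<alpha> s x)"
  by (simp add: simple_reflection_def)

lemma form_reflection_right: "B u (\<sigma> s v) = B u v - 2 * B (\<alpha> s) v * B u (\<alpha> s)"
  unfolding reflection_alt form_linear_right by simp

lemma form_reflection_left: "B (\<sigma> s v) u = B v u - 2 * B (\<alpha> s) v * B (\<alpha> s) u"
  unfolding reflection_alt form_linear_left by simp

lemma form_reflection: "s \<in> S \<Longrightarrow> B (\<sigma> s u) (\<sigma> s v) = B u v"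
  by (simp add: form_reflection_right form_reflection_left form_commute[of u "\<alpha> s"]
      algebra_simps)

lemma reflection_linear:
  "\<sigma> s (\<lambda>x. a * u x + b * v x) = (\<lambda>x. a * \<sigma> s u x + b * \<sigma> s v x)"
  unfolding simple_reflection_def form_linear_right by (simp add: algebra_simps)

lemma reflection_simple_root: "s \<in> S \<Longrightarrow> \<sigma> s (\<alpha> s) = (\<lambda>x. - \<alpha> s x)"
  by (simp add: simple_reflection_def fun_eq_iff)

lemma reflection_involution: "s \<in> S \<Longrightarrow> \<sigma> s (\<sigma> s v) = v"
  by (simp add: simple_reflection_def[of _ _ _ "\<sigma> s v"] form_reflection_right)
    (simp add: simple_reflection_def)

lemma foldr_reflection_linear:
  "foldr \<sigma> ws (\<lambda>x. a * u x + b * v x) = (\<lambda>x. a * foldr \<sigma> ws u x + b * foldr \<sigma> ws v x)"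
  by (induction ws) (simp_all add: reflection_linear)

lemma foldr_reflection_form:
  "ws \<in> lists S \<Longrightarrow> B (foldr \<sigma> ws u) (foldr \<sigma> ws v) = B u v"
  by (induction ws) (simp_all add: form_reflection)

lemma foldr_reflection_outside: "x \<notin> set ws \<Longrightarrow> foldr \<sigma> ws v x = v x"
  by (induction ws) (auto simp: simple_reflection_def simple_root_def)

text \<open>In the plane spanned by two simple roots a vector is recorded by a complex number, on which
  the product of the two reflections acts as a rotation.\<close>

lemma reflection_product_rotation:
  assumes st: "s \<in> S" "t \<in> S" "s \<noteq> t"
  defines "\<theta> \<equiv> pi / real (coxeter_m W s t)"
  defines "Z \<equiv> \<lambda>v. Complex (B (\<alpha> s) v) ((B (\<alpha> t) v + B (\<alpha> s) v * cos \<theta>) / sin \<theta>)"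
  shows "Z (\<sigma> s (\<sigma> t v)) = Z v * cis (2 * \<theta>)"
proof -
  have "coxeter_m W s t \<ge> 2" using coxeter_m_ge_two st by blast
  then have "sin \<theta> > 0" unfolding \<theta>_def by (intro sin_gt_zero) (auto simp: field_simps)
  then have sin: "sin \<theta> \<noteq> 0" by simp
  have st': "B (\<alpha> s) (\<alpha> t) = - cos \<theta>" "B (\<alpha> t) (\<alpha> s) = - cos \<theta>"
    using st by (simp_all add: form_simple_roots \<theta>_def coxeter_m_commute[of t s])
  define p where "p = B (\<alpha> s) v"
  define u where "u = (B (\<alpha> t) v + p * cos \<theta>) / sin \<theta>"
  have q: "B (\<alpha> t) v = u * sin \<theta> - p * cos \<theta>" using sin by (simp add: u_def)
  have sq: "cos \<theta> * cos \<theta> = 1 - sin \<theta> * sin \<theta>"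
    using sin_cos_squared_add[of \<theta>] by (simp add: power2_eq_square)
  have Zv: "Z v = Complex p u" by (simp add: Z_def p_def u_def)
  \<comment> \<open>With cosine and sine as opaque \<open>C\<close> and \<open>D\<close> both
    coordinates become polynomial identities; \<open>CD\<close> is supplied multiplied by the
    monomials to which it is applied.\<close>
  define C where "C = cos \<theta>"
  define D where "D = sin \<theta>"
  have CD: "C * C = 1 - D * D" using sq by (simp add: C_def D_def)
  have "B (\<alpha> s) (\<sigma> s (\<sigma> t v)) = - (p + 2 * C * (u * D - p * C))"
    using st by (simp add: form_reflection_right st' p_def[symmetric] q
        C_def[symmetric] D_def[symmetric] algebra_simps)
  also have "\<dots> = p * (C * C - D * D) - u * (2 * D * C)"
    using arg_cong[OF CD, of "(*) p"] by (simp add: algebra_simps)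
  finally have 1: "B (\<alpha> s) (\<sigma> s (\<sigma> t v)) = p * cos (2 * \<theta>) - u * sin (2 * \<theta>)"
    by (simp add: C_def D_def cos_double sin_double power2_eq_square)
  have "B (\<alpha> t) (\<sigma> s (\<sigma> t v)) + B (\<alpha> s) (\<sigma> s (\<sigma> t v)) * C =
      - (u * D - p * C) + C * (p + 2 * C * (u * D - p * C))"
    using st by (simp add: form_reflection_right st' p_def[symmetric] q
        C_def[symmetric] D_def[symmetric] algebra_simps)
  also have "\<dots> = (u * (C * C - D * D) + p * (2 * D * C)) * D"
    using arg_cong[OF CD, of "(*) (u * D)"] arg_cong[OF CD, of "(*) (p * C)"]
    by (simp add: algebra_simps)
  finally have "B (\<alpha> t) (\<sigma> s (\<sigma> t v)) + B (\<alpha> s) (\<sigma> s (\<sigma> t v)) * cos \<theta> =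
      (u * cos (2 * \<theta>) + p * sin (2 * \<theta>)) * sin \<theta>"
    by (simp add: C_def D_def cos_double sin_double power2_eq_square)
  then show ?thesis
    using sin by (simp add: Zv) (simp add: Z_def 1 complex_eq_iff)
qed

text \<open>The rotation argument sees \<open>v\<close> only through its two form values, so a full
  turn restores just these. The difference from \<open>v\<close> lies in the span of
  \<open>\<alpha> s\<close> and \<open>\<alpha> t\<close>, where the form is nondegenerate because
  \<open>sin \<theta>\<close> is nonzero, and so it vanishes.\<close>

lemma reflection_relation:
  assumes st: "s \<in> S" "t \<in> S"
  shows "foldr \<sigma> (concat (replicate (coxeter_m W s t) [s, t])) v = v"
proof (cases "s = t")
  case True
  then show ?thesis using st by (simp add: reflection_involution)
next
  case False
  define \<theta> where "\<theta> = pi / real (coxeter_m W s t)"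
  define Z where "Z = (\<lambda>v. Complex (B (\<alpha> s) v) ((B (\<alpha> t) v + B (\<alpha> s) v * cos \<theta>) / sin \<theta>))"
  let ?v = "\<lambda>n. foldr \<sigma> (concat (replicate n [s, t])) v"
  have rot: "Z (\<sigma> s (\<sigma> t v)) = Z v * cis (2 * \<theta>)" for v
    using reflection_product_rotation[OF st False] by (simp add: \<theta>_def Z_def)
  have m2: "coxeter_m W s t \<ge> 2" using coxeter_m_ge_two st False by blast
  then have sin: "sin \<theta> > 0"
    unfolding \<theta>_def by (intro sin_gt_zero) (auto simp: field_simps)
  have "Z (?v n) = Z v * cis (2 * \<theta>) ^ n" for n
    by (induction n) (simp_all add: rot)
  moreover have "cis (2 * \<theta>) ^ coxeter_m W s t = 1"
    using m2 by (simp add: DeMoivre \<theta>_def)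
  ultimately have Z: "Z (?v (coxeter_m W s t)) = Z v" by simp
  have "\<exists>x y. ?v n = (\<lambda>z. v z + x * \<alpha> s z + y * \<alpha> t z)" for n
  proof (induction n)
    case 0
    show ?case by (intro exI[of _ 0]) simp
  next
    case (Suc n)
    then obtain x y where xy: "?v n = (\<lambda>z. v z + x * \<alpha> s z + y * \<alpha> t z)" by blast
    have "\<sigma> s (\<sigma> t u) =
        (\<lambda>z. u z - 2 * B (\<alpha> t) u * \<alpha> t z - 2 * B (\<alpha> s) (\<sigma> t u) * \<alpha> s z)" for u
      by (simp add: simple_reflection_def)
    from this[of "?v n"] show ?case
      by (intro exI[of _ "x - 2 * B (\<alpha> s) (\<sigma> t (?v n))"] exI[of _ "y - 2 * B (\<alpha> t) (?v n)"])
        (simp add: xy algebra_simps fun_eq_iff)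
  qed
  then obtain x y where xy: "?v (coxeter_m W s t) = (\<lambda>z. v z + x * \<alpha> s z + y * \<alpha> t z)"
    by blast
  have B: "B u (\<lambda>z. v z + x * \<alpha> s z + y * \<alpha> t z) = B u v + x * B u (\<alpha> s) + y * B u (\<alpha> t)" for u
    using form_linear_right[of u 1 "\<lambda>z. 1 * v z + x * \<alpha> s z" y "\<alpha> t"]
      form_linear_right[of u 1 v x "\<alpha> s"] by simp
  have st': "B (\<alpha> s) (\<alpha> t) = - cos \<theta>" "B (\<alpha> t) (\<alpha> s) = - cos \<theta>"
    using st by (simp_all add: form_simple_roots \<theta>_def coxeter_m_commute[of t s])
  have x: "x = y * cos \<theta>" using Z st by (simp add: Z_def xy B st')
  moreover have "B (\<alpha> t) (?v (coxeter_m W s t)) = B (\<alpha> t) v"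
    using Z sin by (auto simp: Z_def divide_cancel_right)
  then have y: "y = x * cos \<theta>" using st by (simp add: xy B st')
  then have "y * (1 - (cos \<theta>)\<^sup>2) = 0" using x by (simp add: power2_eq_square algebra_simps)
  then have "y = 0" using sin by (simp add: sin_squared_eq[symmetric])
  then show ?thesis using x xy by simp
qed

text \<open>The presentation reduces this to the relators. It is what gives the \<open>THE\<close>
  in \<open>reflection_rep\<close> a value.\<close>

lemma foldr_reflection_cong:
  assumes "us \<in> lists S" "vs \<in> lists S" "wp us = wp vs"
  shows "foldr \<sigma> us v = foldr \<sigma> vs v"
proof -
  have "(us, vs) \<in> (relator_insertion W S \<union> (relator_insertion W S)\<inverse>)\<^sup>*"
    using presentation assms by blast
  then show ?thesis
    by induction (auto simp: relator_insertion_def reflection_relation)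
qed

lemma rep_word: "ws \<in> lists S \<Longrightarrow> \<rho> (wp ws) v = foldr \<sigma> ws v"
  unfolding reflection_rep_def
  by (rule the_equality) (use foldr_reflection_cong in blast)+

lemma rep_one [simp]: "\<rho> \<one> v = v"
  using rep_word[of "[]"] by simp

lemma rep_generator: "s \<in> S \<Longrightarrow> \<rho> s v = \<sigma> s v"
  using rep_word[of "[s]"] by simp

lemma rep_mult: "u \<in> carrier W \<Longrightarrow> w \<in> carrier W \<Longrightarrow> \<rho> (u \<otimes> w) v = \<rho> u (\<rho> w v)"
proof -
  assume "u \<in> carrier W" "w \<in> carrier W"
  then obtain us ws where "us \<in> lists S" "wp us = u" "ws \<in> lists S" "wp ws = w"
    using word_exists by metis
  then show ?thesis
    using rep_word[of "us @ ws"] rep_word[of us] rep_word[of ws] word_prod_append[of us ws]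
    by simp
qed

lemma rep_linear:
  assumes "w \<in> carrier W"
  shows "\<rho> w (\<lambda>x. a * u x + b * v x) = (\<lambda>x. a * \<rho> w u x + b * \<rho> w v x)"
  using word_exists[OF assms] by (metis rep_word foldr_reflection_linear)

lemma rep_form: "w \<in> carrier W \<Longrightarrow> B (\<rho> w u) (\<rho> w v) = B u v"
  using word_exists[of w] by (metis rep_word foldr_reflection_form)

lemma rep_inv_cancel [simp]:
  "w \<in> carrier W \<Longrightarrow> \<rho> (inv w) (\<rho> w v) = v"
  "w \<in> carrier W \<Longrightarrow> \<rho> w (\<rho> (inv w) v) = v"
  by (simp_all flip: rep_mult)

lemma rep_outside: "w \<in> carrier W \<Longrightarrow> x \<notin> S \<Longrightarrow> \<rho> w v x = v x"
  using word_exists[of w] by (metis rep_word foldr_reflection_outside in_lists_conv_set)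

lemma rep_uminus: "w \<in> carrier W \<Longrightarrow> \<rho> w (\<lambda>x. - v x) = (\<lambda>x. - \<rho> w v x)"
  using rep_linear[of w "-1" v 0 v] by simp

lemma rep_zero: "w \<in> carrier W \<Longrightarrow> \<rho> w (\<lambda>x. 0) = (\<lambda>x. 0)"
  using rep_linear[of w 0 _ 0] by simp

lemma rep_sum:
  assumes "w \<in> carrier W" "finite I"
  shows "\<rho> w (\<lambda>x. \<Sum>i\<in>I. a i * v i x) = (\<lambda>x. \<Sum>i\<in>I. a i * \<rho> w (v i) x)"
  using assms(2)
proof induction
  case empty
  then show ?case using assms by (simp add: rep_zero)
next
  case (insert i I)
  then show ?case
    using rep_linear[OF assms(1), of "a i" "v i" 1 "\<lambda>x. \<Sum>i\<in>I. a i * v i x"] by simp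
qed

end

section \<open>Roots and the longest element\<close>

text \<open>The word grows on the left, so its last letter is \<open>t\<close> at every positive
  length; this suits splitting right factors off a group element.\<close>

fun alternating_word :: "'a \<Rightarrow> 'a \<Rightarrow> nat \<Rightarrow> 'a list" where
  "alternating_word s t 0 = []"
| "alternating_word s t (Suc j) = (if even j then t else s) # alternating_word s t j"

lemma length_alternating_word [simp]: "length (alternating_word s t j) = j"
  by (induction j) auto

lemma alternating_word_in_lists: "s \<in> A \<Longrightarrow> t \<in> A \<Longrightarrow> alternating_word s t j \<in> lists A"
  by (induction j) auto

lemma alternating_word_suffix:
  "s \<in> A \<Longrightarrow> t \<in> A \<Longrightarrow>
    \<exists>us\<in>lists A. length us = i \<and> alternating_word s t (i + j) = us @ alternating_word s t j"
proof (induction i)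
  case (Suc i)
  then obtain us where "us \<in> lists A" "length us = i"
    "alternating_word s t (i + j) = us @ alternating_word s t j"
    by blast
  with Suc.prems show ?case
    by (intro bexI[of _ "(if even (i + j) then t else s) # us"]) auto
qed simp

definition nonneg :: "('a \<Rightarrow> real) \<Rightarrow> bool" where
  "nonneg v \<longleftrightarrow> (\<forall>x. v x \<ge> 0)"

definition nonpos :: "('a \<Rightarrow> real) \<Rightarrow> bool" where
  "nonpos v \<longleftrightarrow> (\<forall>x. v x \<le> 0)"

lemma nonpos_uminus [simp]: "nonpos (\<lambda>x. - v x) \<longleftrightarrow> nonneg v"
  and nonneg_uminus [simp]: "nonneg (\<lambda>x. - v x) \<longleftrightarrow> nonpos v"
  by (simp_all add: nonpos_def nonneg_def)

lemma nonneg_simple_root [simp]: "nonneg (simple_root s)"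
  by (simp add: nonneg_def simple_root_def)

section \<open>Alternating words and Tits' theorem on ascents\<close>

context finite_coxeter_system
begin

lemma conjugate_pow:
  assumes "s \<in> S" "t \<in> S"
  shows "t \<otimes> (s \<otimes> t) [^] (n::nat) \<otimes> s = (t \<otimes> s) [^] Suc n"
proof (induction n)
  case (Suc n)
  have "t \<otimes> (s \<otimes> t) [^] Suc n \<otimes> s = t \<otimes> (s \<otimes> t) [^] n \<otimes> s \<otimes> (t \<otimes> s)"
    using assms by (simp add: m_assoc)
  also have "\<dots> = (t \<otimes> s) [^] Suc (Suc n)" by (subst Suc.IH) simp
  finally show ?case .
qed (use assms in simp)

text \<open>Prepending a letter to each word conjugates the quotient and exchanges the roles of
  \<open>s\<close> and \<open>t\<close>, hence the parity split. At length \<open>m(s,t)\<close> the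
  power is trivial, which is the braid relation.\<close>

lemma alternating_word_quotient:
  assumes "s \<in> S" "t \<in> S"
  shows "wp (alternating_word s t j) \<otimes> inv (wp (alternating_word t s j)) =
    (if even j then s \<otimes> t else t \<otimes> s) [^] j"
proof (induction j)
  case (Suc j)
  let ?a = "wp (alternating_word s t j)" and ?b = "wp (alternating_word t s j)"
  have cl: "?a \<in> carrier W" "?b \<in> carrier W"
    using alternating_word_in_lists[of _ S] assms by blast+
  define x where "x = (if even j then t else s)"
  define y where "y = (if even j then s else t)"
  have xy: "x \<in> S" "y \<in> S" using assms by (auto simp: x_def y_def)
  have "wp (alternating_word s t (Suc j)) \<otimes> inv (wp (alternating_word t s (Suc j))) =
      x \<otimes> ?a \<otimes> inv (y \<otimes> ?b)"
    by (simp add: x_def y_def)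
  also have "\<dots> = x \<otimes> (?a \<otimes> inv ?b) \<otimes> y"
    using cl xy by (simp add: inv_mult_group m_assoc)
  also have "\<dots> = x \<otimes> (y \<otimes> x) [^] j \<otimes> y"
    unfolding Suc.IH by (simp add: x_def y_def)
  also have "\<dots> = (x \<otimes> y) [^] Suc j"
    using conjugate_pow xy by blast
  finally show ?case by (simp add: x_def y_def)
qed simp

lemma braid_relation:
  assumes "s \<in> S" "t \<in> S"
  shows "wp (alternating_word s t (coxeter_m W s t)) = wp (alternating_word t s (coxeter_m W s t))"
proof -
  let ?m = "coxeter_m W s t"
  have "(s \<otimes> t) [^] ?m = \<one>" "(t \<otimes> s) [^] ?m = \<one>"
    using assms pow_ord_eq_1[of "s \<otimes> t"] pow_ord_eq_1[of "t \<otimes> s"] coxeter_m_commute[OF assms]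
    unfolding coxeter_m_def by (metis m_closed generator_closed)+
  then have "wp (alternating_word s t ?m) \<otimes> inv (wp (alternating_word t s ?m)) = \<one>"
    using alternating_word_quotient[OF assms, of ?m] by (simp split: if_splits)
  moreover have "wp (alternating_word s t ?m) \<in> carrier W" "wp (alternating_word t s ?m) \<in> carrier W"
    using alternating_word_in_lists[of _ S] assms by blast+
  ultimately show ?thesis
    by (metis inv_closed inv_equality inv_inv)
qed

text \<open>Each reflection replaces one coefficient by \<open>2 * cos \<theta>\<close> times the
  other minus itself. This is the Chebyshev recursion, solved by quotients of sines; both are
  nonnegative as long as \<open>j < m(s,t)\<close>.\<close>

lemma alternating_word_root:
  assumes "s \<in> S" "t \<in> S" "s \<noteq> t"
  defines "\<theta> \<equiv> pi / real (coxeter_m W s t)"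
  shows "foldr \<sigma> (alternating_word s t j) (\<alpha> s) =
    (\<lambda>x. (if even j then sin ((real j + 1) * \<theta>) else sin (real j * \<theta>)) / sin \<theta> * \<alpha> s x +
         (if even j then sin (real j * \<theta>) else sin ((real j + 1) * \<theta>)) / sin \<theta> * \<alpha> t x)"
proof (induction j)
  case 0
  have "coxeter_m W s t \<ge> 2" using coxeter_m_ge_two assms by blast
  then have "sin \<theta> > 0" unfolding \<theta>_def by (intro sin_gt_zero) (auto simp: field_simps)
  then show ?case by simp
next
  case (Suc j)
  have "coxeter_m W s t \<ge> 2" using coxeter_m_ge_two assms by blast
  then have "sin \<theta> > 0" unfolding \<theta>_def by (intro sin_gt_zero) (auto simp: field_simps)
  then have sin: "sin \<theta> \<noteq> 0" by simp
  have st: "B (\<alpha> s) (\<alpha> t) = - cos \<theta>" "B (\<alpha> t) (\<alpha> s) = - cos \<theta>"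
    using assms by (simp_all add: form_simple_roots \<theta>_def coxeter_m_commute[of t s])
  have trig: "2 * cos \<theta> * sin ((real j + 1) * \<theta>) - sin (real j * \<theta>) = sin ((real j + 2) * \<theta>)"
  proof -
    have "sin ((real j + 2) * \<theta>) = sin ((real j + 1) * \<theta> + \<theta>)"
      "sin (real j * \<theta>) = sin ((real j + 1) * \<theta> - \<theta>)"
      by (simp_all add: algebra_simps)
    then show ?thesis by (simp add: sin_add sin_diff)
  qed
  let ?u = "\<lambda>a b x. a * \<alpha> s x + b * \<alpha> t x"
  have refl_t: "\<sigma> t (?u a b) = ?u a (2 * cos \<theta> * a - b)" for a b
    unfolding simple_reflection_def form_linear_right using assms st
    by (simp add: algebra_simps fun_eq_iff)
  have refl_s: "\<sigma> s (?u a b) = ?u (2 * cos \<theta> * b - a) b" for a b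
    unfolding simple_reflection_def form_linear_right using assms st
    by (simp add: algebra_simps fun_eq_iff)
  have trig': "2 * cos \<theta> * (sin ((real j + 1) * \<theta>) / sin \<theta>) - sin (real j * \<theta>) / sin \<theta> =
      sin ((real j + 2) * \<theta>) / sin \<theta>"
    using trig by (simp add: diff_divide_distrib[symmetric])
  have eq: "real (Suc j) + 1 = real j + 2" "real (Suc j) = real j + 1" by simp_all
  show ?case
  proof (cases "even j")
    case True
    then have "foldr \<sigma> (alternating_word s t (Suc j)) (\<alpha> s) =
        \<sigma> t (?u (sin ((real j + 1) * \<theta>) / sin \<theta>) (sin (real j * \<theta>) / sin \<theta>))"
      using Suc.IH by simp
    also have "\<dots> = ?u (sin ((real j + 1) * \<theta>) / sin \<theta>) (sin ((real j + 2) * \<theta>) / sin \<theta>)"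
      unfolding refl_t trig' ..
    finally show ?thesis unfolding eq using True by (simp add: add.commute)
  next
    case False
    then have "foldr \<sigma> (alternating_word s t (Suc j)) (\<alpha> s) =
        \<sigma> s (?u (sin (real j * \<theta>) / sin \<theta>) (sin ((real j + 1) * \<theta>) / sin \<theta>))"
      using Suc.IH by simp
    also have "\<dots> = ?u (sin ((real j + 2) * \<theta>) / sin \<theta>) (sin ((real j + 1) * \<theta>) / sin \<theta>)"
      unfolding refl_s trig' ..
    finally show ?thesis unfolding eq using False by (simp add: add.commute)
  qed
qed

text \<open>The key to Tits' theorem: split off from \<open>w\<close> the longest possible alternating word
  \<open>\<dots>t s t\<close> ending in a descent \<open>t\<close>; the remaining factor has neither \<open>s\<close> nor \<open>t\<close> as a descent, and
  the alternating part is too short for its root coefficients to become negative.\<close>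

theorem ascent_root_nonneg:
  assumes "w \<in> carrier W" "s \<in> S" "len w < len (w \<otimes> s)"
  shows "nonneg (\<rho> w (\<alpha> s))"
  using assms
proof (induction "len w" arbitrary: w s rule: less_induct)
  case less
  show ?case
  proof (cases "w = \<one>")
    case True
    then show ?thesis by simp
  next
    case False
    then obtain t where t: "t \<in> S" "len w = Suc (len (w \<otimes> t))"
      using descent_exists less.prems by metis
    then have "s \<noteq> t" using less.prems by auto
    note s = \<open>s \<in> S\<close> and w = \<open>w \<in> carrier W\<close>
    let ?a = "alternating_word s t"
    have al: "?a j \<in> lists S" for j using alternating_word_in_lists s t by metis
    then have ac: "wp (?a j) \<in> carrier W" for j by blast
    \<comment> \<open>Lengths of alternating right factors that split off without loss of length.
      The descent \<open>t\<close> puts 1 into \<open>J\<close>, so the remaining \<open>v\<close>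
      is shorter than \<open>w\<close> and the induction hypothesis applies to it.\<close>
    define J where "J = {j. \<exists>v\<in>carrier W. w = v \<otimes> wp (?a j) \<and> len w = len v + j}"
    have J1: "1 \<in> J"
      unfolding J_def using t w by (auto intro!: bexI[of _ "w \<otimes> t"])
    have fin: "finite J" by (rule finite_subset[of _ "{..len w}"]) (auto simp: J_def)
    define j where "j = Max J"
    have j1: "j \<ge> 1" unfolding j_def using fin J1 by simp
    have "j \<in> J" unfolding j_def using fin J1 by (intro Max_in) auto
    then obtain v where v: "v \<in> carrier W" "w = v \<otimes> wp (?a j)" "len w = len v + j"
      by (auto simp: J_def)
    \<comment> \<open>\<open>x\<close> is the letter that would extend the alternating word on the
      left, \<open>y\<close> its present first letter. A descent \<open>x\<close> of
      \<open>v\<close> contradicts the maximality of \<open>j\<close>, a descent \<open>y\<close>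
      contradicts the length of \<open>w\<close>.\<close>
    define x where "x = (if even j then t else s)"
    define y where "y = (if even j then s else t)"
    have xy: "x \<in> S" "y \<in> S" using s t by (auto simp: x_def y_def)
    have "len v < len (v \<otimes> x)"
    proof (rule ccontr)
      assume "\<not> ?thesis"
      then have "len v = Suc (len (v \<otimes> x))"
        using length_mult_generator_cases[OF v(1) xy(1)] by force
      moreover have "w = (v \<otimes> x) \<otimes> wp (?a (Suc j))"
      proof -
        have "(v \<otimes> x) \<otimes> wp (?a (Suc j)) = v \<otimes> x \<otimes> (x \<otimes> wp (?a j))" by (simp add: x_def)
        also have "\<dots> = v \<otimes> (x \<otimes> (x \<otimes> wp (?a j)))"
          using v(1) xy ac by (simp only: m_assoc m_closed generator_closed)
        also have "\<dots> = w" using v xy ac by simp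
        finally show ?thesis by simp
      qed
      ultimately have "Suc j \<in> J" using v xy unfolding J_def by force
      then have "Suc j \<le> j" unfolding j_def using fin by (rule Max_ge[rotated])
      then show False by simp
    qed
    moreover have "len v < len (v \<otimes> y)"
    proof (rule ccontr)
      assume "\<not> ?thesis"
      then have lv: "len v = Suc (len (v \<otimes> y))"
        using length_mult_generator_cases[OF v(1) xy(2)] by force
      obtain i where i: "j = Suc i" using j1 by (cases j) auto
      have "w = v \<otimes> (y \<otimes> wp (?a i))" using v i by (simp add: y_def)
      also have "\<dots> = (v \<otimes> y) \<otimes> wp (?a i)" using v xy ac by (simp add: m_assoc)
      finally have "len w \<le> len (v \<otimes> y) + len (wp (?a i))"
        using length_mult_le[of "v \<otimes> y" "wp (?a i)"] v(1) xy ac by simp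
      also have "\<dots> \<le> len (v \<otimes> y) + i" using length_word_ge[OF al, of i] by simp
      finally show False using lv v i by simp
    qed
    ultimately have "len v < len (v \<otimes> s)" "len v < len (v \<otimes> t)"
      by (auto simp: x_def y_def split: if_splits)
    then have pos: "nonneg (\<rho> v (\<alpha> s))" "nonneg (\<rho> v (\<alpha> t))"
      using less.hyps[of v] v j1 s t by auto
    \<comment> \<open>Otherwise the braid relation rewrites the last \<open>m(s,t)\<close> letters
      to end in \<open>s\<close>, and \<open>s\<close> would be a descent of
      \<open>w\<close>.\<close>
    have "j < coxeter_m W s t"
    proof (rule ccontr)
      let ?m = "coxeter_m W s t"
      assume "\<not> ?thesis"
      then have "j = (j - ?m) + ?m" by simp
      then obtain us where us: "us \<in> lists S" "length us = j - ?m" "?a j = us @ ?a ?m"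
        using alternating_word_suffix[of s S t "j - ?m" ?m] s t by metis
      have "alternating_word t s ?m = alternating_word t s ((?m - 1) + 1)"
        using coxeter_m_pos[of s t] s t by simp
      then obtain vs where vs: "vs \<in> lists S" "length vs = ?m - 1"
        "alternating_word t s ?m = vs @ [s]"
        using alternating_word_suffix[of t S s "?m - 1" 1] s t by auto
      have "wp (?a j) = wp us \<otimes> wp (?a ?m)" using us word_prod_append[OF us(1) al[of ?m]] by simp
      also have "wp (?a ?m) = wp (vs @ [s])" using braid_relation[OF s t(1)] vs by simp
      also have "\<dots> = wp vs \<otimes> s" using word_prod_append[of vs "[s]"] vs s by simp
      finally have aj: "wp (?a j) = wp us \<otimes> (wp vs \<otimes> s)" .
      have "wp us \<in> carrier W" "wp vs \<in> carrier W" using us vs by blast+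
      then have "w \<otimes> s = v \<otimes> (wp us \<otimes> wp vs)"
        using aj v s by (simp add: m_assoc)
      also have "\<dots> = v \<otimes> wp (us @ vs)" using word_prod_append us vs by simp
      finally have "w \<otimes> s = v \<otimes> wp (us @ vs)" .
      moreover have usvs: "us @ vs \<in> lists S" using us vs by simp
      ultimately have "len (w \<otimes> s) \<le> len v + len (wp (us @ vs))"
        using length_mult_le[OF v(1) word_prod_closed[OF usvs]] by simp
      also have "\<dots> \<le> len v + length (us @ vs)" using length_word_ge[OF usvs] by simp
      also have "\<dots> < len w"
        using v us vs \<open>\<not> j < ?m\<close> coxeter_m_pos[of s t] s t by simp
      finally show False using less.prems by simp
    qed
    then have m: "j + 1 \<le> coxeter_m W s t" by simp
    define \<theta> where "\<theta> = pi / real (coxeter_m W s t)"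
    have sin: "sin (real i * \<theta>) \<ge> 0" if "i \<le> coxeter_m W s t" for i
    proof (rule sin_ge_zero)
      show "0 \<le> real i * \<theta>" by (simp add: \<theta>_def)
      have "real i * \<theta> \<le> real (coxeter_m W s t) * \<theta>"
        using that by (intro mult_right_mono) (auto simp: \<theta>_def)
      also have "\<dots> = pi" using m by (simp add: \<theta>_def)
      finally show "real i * \<theta> \<le> pi" .
    qed
    have sins: "sin (real j * \<theta>) \<ge> 0" "sin ((real j + 1) * \<theta>) \<ge> 0" "sin \<theta> \<ge> 0"
      using sin[of j] sin[of "j + 1"] sin[of 1] m j1 by (simp_all add: algebra_simps)
    define a where "a = (if even j then sin ((real j + 1) * \<theta>) else sin (real j * \<theta>)) / sin \<theta>"
    define b where "b = (if even j then sin (real j * \<theta>) else sin ((real j + 1) * \<theta>)) / sin \<theta>"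
    have ab: "a \<ge> 0" "b \<ge> 0" using sins by (auto simp: a_def b_def)
    have "\<rho> w (\<alpha> s) = \<rho> v (foldr \<sigma> (?a j) (\<alpha> s))"
      using v ac rep_word[OF al] by (simp add: rep_mult)
    also have "\<dots> = \<rho> v (\<lambda>x. a * \<alpha> s x + b * \<alpha> t x)"
      using alternating_word_root[OF s t(1) \<open>s \<noteq> t\<close>, of j] by (simp add: a_def b_def \<theta>_def)
    also have "\<dots> = (\<lambda>x. a * \<rho> v (\<alpha> s) x + b * \<rho> v (\<alpha> t) x)" using v by (simp add: rep_linear)
    finally show ?thesis using ab pos by (simp add: nonneg_def)
  qed
qed

end

section \<open>Signs of roots\<close>

context finite_coxeter_system
begin

lemma descent_root_nonpos:
  assumes "w \<in> carrier W" "s \<in> S" "len (w \<otimes> s) < len w"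
  shows "nonpos (\<rho> w (\<alpha> s))"
proof -
  have "nonneg (\<rho> (w \<otimes> s) (\<alpha> s))"
    using assms by (intro ascent_root_nonneg) auto
  also have "\<rho> (w \<otimes> s) (\<alpha> s) = (\<lambda>x. - \<rho> w (\<alpha> s) x)"
    using assms by (simp add: rep_mult rep_generator reflection_simple_root rep_uminus)
  finally show ?thesis by simp
qed

definition roots :: "('a \<Rightarrow> real) set" where
  "roots = {\<rho> w (\<alpha> s) | w s. w \<in> carrier W \<and> s \<in> S}"

lemma rootI: "w \<in> carrier W \<Longrightarrow> s \<in> S \<Longrightarrow> \<rho> w (\<alpha> s) \<in> roots"
  by (auto simp: roots_def)

lemma simple_root_in_roots: "s \<in> S \<Longrightarrow> \<alpha> s \<in> roots"
  using rootI[of \<one> s] by simp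

lemma foldr_root: "ws \<in> lists S \<Longrightarrow> s \<in> S \<Longrightarrow> foldr \<sigma> ws (\<alpha> s) \<in> roots"
  using rootI[OF word_prod_closed[of ws], of s] rep_word[of ws "\<alpha> s"] by simp

lemma rep_root: "w \<in> carrier W \<Longrightarrow> \<beta> \<in> roots \<Longrightarrow> \<rho> w \<beta> \<in> roots"
proof -
  assume w: "w \<in> carrier W" "\<beta> \<in> roots"
  then obtain u s where us: "u \<in> carrier W" "s \<in> S" "\<beta> = \<rho> u (\<alpha> s)" by (auto simp: roots_def)
  then show ?thesis using rootI[of "w \<otimes> u" s] w rep_mult[of w u "\<alpha> s"] by simp
qed

lemma uminus_root: "\<beta> \<in> roots \<Longrightarrow> (\<lambda>x. - \<beta> x) \<in> roots"
proof -
  assume "\<beta> \<in> roots"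
  then obtain w s where ws: "w \<in> carrier W" "s \<in> S" "\<beta> = \<rho> w (\<alpha> s)" by (auto simp: roots_def)
  then have "\<rho> (w \<otimes> s) (\<alpha> s) = (\<lambda>x. - \<beta> x)"
    by (simp add: rep_mult rep_generator reflection_simple_root rep_uminus)
  then show ?thesis using rootI[of "w \<otimes> s" s] ws by simp
qed

lemma root_outside: "\<beta> \<in> roots \<Longrightarrow> x \<notin> S \<Longrightarrow> \<beta> x = 0"
  by (auto simp: roots_def rep_outside simple_root_def)

lemma root_norm: "\<beta> \<in> roots \<Longrightarrow> B \<beta> \<beta> = 1"
  by (auto simp: roots_def rep_form)

lemma root_nonzero: "\<beta> \<in> roots \<Longrightarrow> \<exists>x\<in>S. \<beta> x \<noteq> 0"
proof (rule ccontr)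
  assume "\<beta> \<in> roots" "\<not> (\<exists>x\<in>S. \<beta> x \<noteq> 0)"
  then have "B \<beta> \<beta> = 0" by (simp add: coxeter_form_def)
  then show False using root_norm[OF \<open>\<beta> \<in> roots\<close>] by simp
qed

lemma root_sign: "\<beta> \<in> roots \<Longrightarrow> nonpos \<beta> \<longleftrightarrow> \<not> nonneg \<beta>"
proof
  assume "\<beta> \<in> roots" "nonpos \<beta>"
  show "\<not> nonneg \<beta>"
  proof
    assume "nonneg \<beta>"
    with \<open>nonpos \<beta>\<close> have "\<beta> x = 0" for x by (simp add: nonneg_def nonpos_def order_antisym)
    then show False using root_nonzero[OF \<open>\<beta> \<in> roots\<close>] by simp
  qed
next
  assume "\<beta> \<in> roots" "\<not> nonneg \<beta>"
  then obtain w s where ws: "w \<in> carrier W" "s \<in> S" "\<beta> = \<rho> w (\<alpha> s)" by (auto simp: roots_def)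
  then show "nonpos \<beta>"
    using \<open>\<not> nonneg \<beta>\<close> ascent_root_nonneg[of w s] descent_root_nonpos[of w s]
      length_mult_generator_neq[of w s] by force
qed

text \<open>Later sign arguments compute a single coordinate; the dichotomy \<open>root_sign\<close>
  extends its sign to the whole root.\<close>

lemma root_nonnegI: "\<beta> \<in> roots \<Longrightarrow> \<beta> x > 0 \<Longrightarrow> nonneg \<beta>"
  using root_sign[of \<beta>] unfolding nonpos_def by (meson not_le)

lemma ascent_iff:
  assumes "w \<in> carrier W" "s \<in> S"
  shows "len (w \<otimes> s) = Suc (len w) \<longleftrightarrow> nonneg (\<rho> w (\<alpha> s))"
  by (rule length_mult_generator_cases[OF assms])
    (use ascent_root_nonneg[OF assms] descent_root_nonpos[OF assms] root_sign[OF rootI[OF assms]]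
      in auto)

lemma descent_iff:
  assumes "w \<in> carrier W" "s \<in> S"
  shows "len w = Suc (len (w \<otimes> s)) \<longleftrightarrow> nonpos (\<rho> w (\<alpha> s))"
  by (rule length_mult_generator_cases[OF assms])
    (use ascent_root_nonneg[OF assms] descent_root_nonpos[OF assms] root_sign[OF rootI[OF assms]]
      in auto)

lemma reduced_snoc:
  assumes "ws \<in> lists S" "s \<in> S"
  shows "len (wp (ws @ [s])) = Suc (length ws) \<longleftrightarrow>
    len (wp ws) = length ws \<and> nonneg (foldr \<sigma> ws (\<alpha> s))"
proof -
  have w: "wp ws \<in> carrier W" using assms by blast
  have "wp (ws @ [s]) = wp ws \<otimes> s" using assms word_prod_append[of ws "[s]"] by simp
  then show ?thesis
    using ascent_iff[OF w assms(2)] length_word_ge[OF assms(1)] rep_word[OF assms(1)]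
      length_mult_generator_le(1)[OF w assms(2)] by auto
qed

lemma vector_expansion:
  assumes "\<And>x. x \<notin> S \<Longrightarrow> v x = 0"
  shows "v = (\<lambda>x. \<Sum>s\<in>S. v s * \<alpha> s x)"
proof
  fix x
  have "(\<Sum>s\<in>S. v s * \<alpha> s x) = (\<Sum>s\<in>S. if s = x then v s else 0)"
    by (rule sum.cong) (auto simp: simple_root_def)
  then show "v x = (\<Sum>s\<in>S. v s * \<alpha> s x)" using assms[of x] by simp
qed

lemma rep_expansion:
  assumes "w \<in> carrier W" "\<And>x. x \<notin> S \<Longrightarrow> v x = 0"
  shows "\<rho> w v x = (\<Sum>s\<in>S. v s * \<rho> w (\<alpha> s) x)"
proof -
  have "v = (\<lambda>x. \<Sum>s\<in>S. v s * \<alpha> s x)" using vector_expansion assms(2) by blast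
  then have "\<rho> w v = \<rho> w (\<lambda>x. \<Sum>s\<in>S. v s * \<alpha> s x)" by (rule arg_cong)
  then show ?thesis using rep_sum[OF assms(1) finite_generators, of v \<alpha>] by simp
qed

text \<open>A nontrivial \<open>w\<close> has a descent, whose simple root it would send to a
  nonpositive vector.\<close>

lemma rep_faithful:
  assumes "w \<in> carrier W" "\<And>s. s \<in> S \<Longrightarrow> \<rho> w (\<alpha> s) = \<alpha> s"
  shows "w = \<one>"
proof (rule ccontr)
  assume "w \<noteq> \<one>"
  then obtain t where "t \<in> S" "len w = Suc (len (w \<otimes> t))"
    using descent_exists assms(1) by metis
  then have "nonpos (\<alpha> t)" using descent_iff[of w t] assms by auto
  then show False using root_sign[OF simple_root_in_roots[OF \<open>t \<in> S\<close>]] by simp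
qed

text \<open>Along a reduced word of \<open>x\<close> each new root is a nonnegative combination of
  simple roots, so \<open>w\<close> makes it nonpositive and every further letter shortens the
  product by one.\<close>

lemma all_descents_length:
  assumes "w \<in> carrier W" "\<And>s. s \<in> S \<Longrightarrow> nonpos (\<rho> w (\<alpha> s))" "x \<in> carrier W"
  shows "len (w \<otimes> x) + len x = len w"
proof -
  obtain xs where xs: "xs \<in> lists S" "wp xs = x" "length xs = len x"
    using assms(3) reduced_word_exists by metis
  have "len (w \<otimes> wp ys) + length ys = len w" if "ys \<in> lists S" "len (wp ys) = length ys" for ys
    using that
  proof (induction ys rule: rev_induct)
    case Nil
    then show ?case using assms by simp
  next
    case (snoc s ys)
    then have ys: "ys \<in> lists S" "s \<in> S" by auto
    then have red: "len (wp ys) = length ys" "nonneg (foldr \<sigma> ys (\<alpha> s))"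
      using snoc.prems reduced_snoc[of ys s] by auto
    have cl: "wp ys \<in> carrier W" using ys by blast
    let ?v = "foldr \<sigma> ys (\<alpha> s)"
    have "\<rho> (w \<otimes> wp ys) (\<alpha> s) = \<rho> w ?v"
      using assms cl ys by (simp add: rep_mult rep_word)
    moreover have "\<rho> w ?v x \<le> 0" for x
    proof -
      have "?v t * \<rho> w (\<alpha> t) x \<le> 0" if "t \<in> S" for t
        using red(2) assms(2)[OF that] by (simp add: nonneg_def nonpos_def mult_nonneg_nonpos)
      then show ?thesis
        using rep_expansion[OF assms(1), of ?v x] root_outside[OF foldr_root[OF ys]]
        by (simp add: sum_nonpos)
    qed
    ultimately have "nonpos (\<rho> (w \<otimes> wp ys) (\<alpha> s))" by (simp add: nonpos_def)
    then have "len (w \<otimes> wp ys) = Suc (len (w \<otimes> wp ys \<otimes> s))"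
      using descent_iff[of "w \<otimes> wp ys" s] assms cl ys by simp
    moreover have "w \<otimes> wp (ys @ [s]) = w \<otimes> wp ys \<otimes> s"
      using ys cl assms word_prod_append[of ys "[s]"] by (simp add: m_assoc)
    ultimately show ?case using snoc.IH[OF ys(1) red(1)] by simp
  qed
  from this[of xs] show ?thesis using xs by simp
qed

section \<open>The longest element and the involution on the generators\<close>

abbreviation "w\<^sub>0 \<equiv> longest_element W S"
abbreviation "\<psi> \<equiv> coxeter_psi W S"

lemma max_length_descents:
  assumes "w \<in> carrier W" "\<forall>v\<in>carrier W. len v \<le> len w" "s \<in> S"
  shows "nonpos (\<rho> w (\<alpha> s))"
  using descent_iff[of w s] assms length_mult_generator_cases[of w s]
  by (metis m_closed generator_closed not_less_eq_eq)

text \<open>Applied to \<open>inv w \<otimes> v\<close>, the previous length formula leaves length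
  zero for this quotient.\<close>

lemma all_descents_unique:
  assumes "w \<in> carrier W" "\<And>s. s \<in> S \<Longrightarrow> nonpos (\<rho> w (\<alpha> s))"
    and "v \<in> carrier W" "len w \<le> len v"
  shows "v = w"
proof -
  have "len (w \<otimes> (inv w \<otimes> v)) + len (inv w \<otimes> v) = len w"
    using assms by (intro all_descents_length) auto
  moreover have "w \<otimes> (inv w \<otimes> v) = v" using assms by (simp flip: m_assoc)
  ultimately have "len (inv w \<otimes> v) = 0" using assms by simp
  then have "inv w \<otimes> v = \<one>" using assms by (simp add: length_zero_iff)
  then show ?thesis using assms by (metis inv_closed inv_equality inv_inv l_inv m_assoc r_one r_inv)
qed

lemma longest_element_props:
  "w\<^sub>0 \<in> carrier W \<and> (\<forall>v\<in>carrier W. len v \<le> len w\<^sub>0)"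
proof -
  have "Max (len ` carrier W) \<in> len ` carrier W"
    by (rule Max_in) (use finite_carrier one_closed in blast)+
  then obtain w where "w \<in> carrier W" "Max (len ` carrier W) = len w" by blast
  then have w: "w \<in> carrier W" "\<forall>v\<in>carrier W. len v \<le> len w"
    using Max_ge[OF finite_imageI[OF finite_carrier], of _ len] by auto
  show ?thesis
    unfolding longest_element_def
  proof (rule theI)
    show "w \<in> carrier W \<and> (\<forall>v\<in>carrier W. len v \<le> len w)" using w by blast
    fix v assume "v \<in> carrier W \<and> (\<forall>u\<in>carrier W. len u \<le> len v)"
    then show "v = w" using all_descents_unique[OF w(1) max_length_descents[OF w]] w by blast
  qed
qed

lemma longest_closed [simp, intro]: "w\<^sub>0 \<in> carrier W"
  using longest_element_props by blast

lemma longest_descents: "s \<in> S \<Longrightarrow> nonpos (\<rho> w\<^sub>0 (\<alpha> s))"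
  using max_length_descents longest_element_props by blast

lemma longest_eqI:
  "w \<in> carrier W \<Longrightarrow> (\<And>s. s \<in> S \<Longrightarrow> nonpos (\<rho> w (\<alpha> s))) \<Longrightarrow> w\<^sub>0 = w"
  using all_descents_unique[of w "w\<^sub>0"] longest_element_props by blast

lemma longest_inv: "inv w\<^sub>0 = w\<^sub>0"
proof -
  have "\<forall>v\<in>carrier W. len v \<le> len (inv w\<^sub>0)"
    using longest_element_props by (simp add: length_inv)
  then show ?thesis using longest_eqI[of "inv w\<^sub>0"] max_length_descents[of "inv w\<^sub>0"] by simp
qed

lemma longest_square [simp]: "w\<^sub>0 \<otimes> w\<^sub>0 = \<one>"
  using r_inv[OF longest_closed] by (simp add: longest_inv)

lemma rep_longest_cancel [simp]: "\<rho> w\<^sub>0 (\<rho> w\<^sub>0 v) = v"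
  by (simp flip: rep_mult)

lemma length_one_generator:
  assumes "w \<in> carrier W" "len w = 1"
  shows "w \<in> S"
proof -
  obtain ws where "ws \<in> lists S" "wp ws = w" "length ws = 1"
    using assms reduced_word_exists by metis
  then show ?thesis by (auto simp: length_Suc_conv)
qed

lemma psi_alt: "\<psi> s = w\<^sub>0 \<otimes> s \<otimes> w\<^sub>0"
  by (simp add: coxeter_psi_def longest_inv)

text \<open>Multiplication by \<open>w\<^sub>0\<close> complements lengths, so doing it on both
  sides returns to length one.\<close>

lemma psi_closed [simp, intro]:
  assumes "s \<in> S"
  shows "\<psi> s \<in> S"
proof -
  note l = all_descents_length[OF longest_closed longest_descents]
  have "len (s \<otimes> w\<^sub>0) = len (inv (s \<otimes> w\<^sub>0))" using assms by (simp add: length_inv)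
  also have "inv (s \<otimes> w\<^sub>0) = w\<^sub>0 \<otimes> s" using assms by (simp add: inv_mult_group longest_inv)
  finally have "len (s \<otimes> w\<^sub>0) + 1 = len w\<^sub>0" using l[of s] assms by (simp add: length_generator)
  then have "len (w\<^sub>0 \<otimes> (s \<otimes> w\<^sub>0)) = 1" using l[of "s \<otimes> w\<^sub>0"] assms by simp
  then show ?thesis using assms by (intro length_one_generator) (simp_all add: psi_alt m_assoc)
qed

lemma psi_involution [simp]: "s \<in> S \<Longrightarrow> \<psi> (\<psi> s) = s"
proof -
  assume s: "s \<in> S"
  have "\<psi> (\<psi> s) = (w\<^sub>0 \<otimes> w\<^sub>0) \<otimes> s \<otimes> (w\<^sub>0 \<otimes> w\<^sub>0)"
    unfolding psi_alt using s by (simp only: m_assoc m_closed longest_closed generator_closed)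
  then show ?thesis using s by simp
qed

text \<open>The reflection of \<open>\<psi> s\<close> negates the image, which is therefore a
  multiple of \<open>\<alpha> (\<psi> s)\<close>. Norm one leaves the factors 1 and -1, and
  \<open>longest_descents\<close> selects -1.\<close>

lemma rep_longest_simple_root:
  assumes "s \<in> S"
  shows "\<rho> w\<^sub>0 (\<alpha> s) = (\<lambda>x. - \<alpha> (\<psi> s) x)"
proof -
  let ?v = "\<rho> w\<^sub>0 (\<alpha> s)"
  define l where "l = B (\<alpha> (\<psi> s)) ?v"
  have "\<sigma> (\<psi> s) ?v = \<rho> w\<^sub>0 (\<sigma> s (\<alpha> s))"
    unfolding rep_generator[OF assms, symmetric] rep_generator[OF psi_closed[OF assms], symmetric]
    using assms by (simp add: psi_alt rep_mult)
  then have "\<sigma> (\<psi> s) ?v = (\<lambda>x. - ?v x)"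
    using assms by (simp add: reflection_simple_root rep_uminus)
  then have "?v x - 2 * l * \<alpha> (\<psi> s) x = - ?v x" for x
    unfolding l_def simple_reflection_def by meson
  then have "2 * ?v x = 2 * (l * \<alpha> (\<psi> s) x)" for x
    by (metis (no_types) add_uminus_conv_diff diff_eq_eq mult.assoc mult_2 add.commute minus_add_cancel)
  then have v: "?v = (\<lambda>x. l * \<alpha> (\<psi> s) x + 0 * \<alpha> (\<psi> s) x)"
    by auto
  have "B ?v ?v = l * l"
    unfolding v form_linear_left form_linear_right using assms by simp
  moreover have "B ?v ?v = 1" using assms root_norm rootI by simp
  ultimately have "l = 1 \<or> l = -1" by (simp add: square_eq_1_iff)
  moreover have "?v (\<psi> s) \<le> 0" using longest_descents[OF assms] by (simp add: nonpos_def)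
  then have "l \<le> 0" by (subst (asm) v) (simp add: simple_root_def)
  ultimately have "l = -1" by linarith
  then show ?thesis using v by simp
qed

lemma rep_longest:
  assumes "\<And>x. x \<notin> S \<Longrightarrow> v x = 0" "x \<in> S"
  shows "\<rho> w\<^sub>0 v x = - v (\<psi> x)"
proof -
  have "\<rho> w\<^sub>0 v x = (\<Sum>s\<in>S. v s * (- \<alpha> (\<psi> s) x))"
    using assms by (subst rep_expansion) (simp_all add: rep_longest_simple_root)
  also have "\<dots> = (\<Sum>s\<in>S. if s = \<psi> x then - v s else 0)"
    using assms by (intro sum.cong) (auto simp: simple_root_def)
  also have "\<dots> = - v (\<psi> x)" using assms by simp
  finally show ?thesis .
qed

text \<open>Turns the case distinction of the theorem into one on letters, which is how the cycles
  of the rotation map see it.\<close>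

lemma acts_as_minus_one_iff: "acts_as_minus_one W S w\<^sub>0 \<longleftrightarrow> (\<forall>s\<in>S. \<psi> s = s)"
proof
  assume a: "acts_as_minus_one W S w\<^sub>0"
  show "\<forall>s\<in>S. \<psi> s = s"
  proof
    fix s assume s: "s \<in> S"
    then have "\<alpha> s \<in> reflection_space S" by (auto simp: reflection_space_def simple_root_def)
    then have "\<rho> w\<^sub>0 (\<alpha> s) = (\<lambda>x. - \<alpha> s x)" using a by (simp add: acts_as_minus_one_def)
    then have "\<alpha> (\<psi> s) s = \<alpha> s s" using rep_longest_simple_root[OF s] by (simp add: fun_eq_iff)
    then show "\<psi> s = s" by (simp add: simple_root_def split: if_splits)
  qed
next
  assume a: "\<forall>s\<in>S. \<psi> s = s"
  have "\<rho> w\<^sub>0 v x = - v x" if "v \<in> reflection_space S" for v x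
    using that a rep_longest[of v x] rep_outside[OF longest_closed, of x v]
    by (cases "x \<in> S") (auto simp: reflection_space_def)
  then show "acts_as_minus_one W S w\<^sub>0" by (auto simp: acts_as_minus_one_def)
qed

end

section \<open>Orbits of a Coxeter element on the roots\<close>

locale coxeter_word = finite_coxeter_system +
  fixes cs :: "'a list"
  assumes distinct_cs: "distinct cs" and set_cs: "set cs = S"
begin

abbreviation "c \<equiv> wp cs"

definition idx :: "'a \<Rightarrow> nat" where
  "idx s = (THE j. j < length cs \<and> cs ! j = s)"

lemma cs_in_lists [simp]: "cs \<in> lists S"
  using set_cs by auto

lemma c_closed [simp, intro]: "c \<in> carrier W"
  using cs_in_lists by (rule word_prod_closed)

lemma idx_nth [simp]: "j < length cs \<Longrightarrow> idx (cs ! j) = j"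
  unfolding idx_def using distinct_cs by (intro the_equality) (auto simp: nth_eq_iff_index_eq)

lemma nth_idx [simp]: "s \<in> S \<Longrightarrow> cs ! idx s = s"
  and idx_less [simp]: "s \<in> S \<Longrightarrow> idx s < length cs"
  using set_cs by (auto simp: in_set_conv_nth)

lemma idx_inj: "s \<in> S \<Longrightarrow> t \<in> S \<Longrightarrow> idx s = idx t \<Longrightarrow> s = t"
  by (metis nth_idx)

lemma nth_in [simp]: "j < length cs \<Longrightarrow> cs ! j \<in> S"
  using set_cs nth_mem by blast

lemma take_in_lists: "take j cs \<in> lists S"
  using set_cs set_take_subset[of j cs] by auto

lemma in_set_take_iff: "s \<in> S \<Longrightarrow> s \<in> set (take j cs) \<longleftrightarrow> idx s < j"
proof
  assume "s \<in> set (take j cs)"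
  then obtain i where i: "i < length cs" "i < j" "cs ! i = s" by (auto simp: in_set_conv_nth)
  then show "idx s < j" using idx_nth[OF i(1)] by simp
next
  assume s: "s \<in> S" and j: "idx s < j"
  then have "take j cs ! idx s = s" "idx s < length (take j cs)" by simp_all
  then show "s \<in> set (take j cs)" by (metis nth_mem)
qed

text \<open>With \<open>cs\<close> read as an orientation of the Coxeter graph, these inversions of
  \<open>c\<close> are the analogues of dimension vectors of indecomposable projective quiver
  representations.\<close>

definition proj :: "'a \<Rightarrow> 'a \<Rightarrow> real" where
  "proj s = foldr \<sigma> (take (idx s) cs) (\<alpha> s)"

text \<open>The last letter acts first and subtracts a multiple of its simple root, which the
  remaining prefix then carries along. For prefixes of \<open>cs\<close> these carried roots are the
  vectors \<open>proj t\<close>.\<close>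

lemma foldr_expansion:
  "foldr \<sigma> ws v x =
    v x - (\<Sum>i<length ws. 2 * B (\<alpha> (ws ! i)) v * foldr \<sigma> (take i ws) (\<alpha> (ws ! i)) x)"
proof (induction ws rule: rev_induct)
  case (snoc s ws)
  have "foldr \<sigma> (ws @ [s]) v x = foldr \<sigma> ws v x - 2 * B (\<alpha> s) v * foldr \<sigma> ws (\<alpha> s) x"
    using foldr_reflection_linear[of ws 1 v "- 2 * B (\<alpha> s) v" "\<alpha> s"]
    by (simp add: reflection_alt)
  then show ?case using snoc.IH by (simp add: nth_append)
qed simp

lemma prefix_expansion:
  assumes "m \<le> length cs"
  shows "foldr \<sigma> (take m cs) v x = v x - (\<Sum>t\<in>{t \<in> S. idx t < m}. 2 * B (\<alpha> t) v * proj t x)"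
proof -
  have "(\<Sum>i<m. 2 * B (\<alpha> (cs ! i)) v * foldr \<sigma> (take i cs) (\<alpha> (cs ! i)) x) =
      (\<Sum>t\<in>{t \<in> S. idx t < m}. 2 * B (\<alpha> t) v * proj t x)"
    using assms by (intro sum.reindex_bij_witness[of _ idx "\<lambda>i. cs ! i"]) (auto simp: proj_def)
  then show ?thesis
    using assms by (simp add: foldr_expansion[of "take m cs"] min_def)
qed

lemma proj_expansion:
  assumes "s \<in> S"
  shows "proj s x = \<alpha> s x - (\<Sum>t\<in>{t \<in> S. idx t < idx s}. 2 * B (\<alpha> t) (\<alpha> s) * proj t x)"
  unfolding proj_def[of s] by (rule prefix_expansion) (use assms idx_less less_imp_le in blast)

lemma rep_c: "\<rho> c v x = v x - (\<Sum>t\<in>S. 2 * B (\<alpha> t) v * proj t x)"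
proof -
  have "{t \<in> S. idx t < length cs} = S" by auto
  then show ?thesis using prefix_expansion[of "length cs" v x] by (simp add: rep_word set_cs)
qed

lemma proj_root: "s \<in> S \<Longrightarrow> proj s \<in> roots"
  unfolding proj_def using take_in_lists by (rule foldr_root)

text \<open>A reflection changes only its own coordinate, and \<open>s\<close> does not occur in the
  prefix before it. With \<open>proj_after\<close> this makes the family \<open>proj\<close>
  unitriangular along \<open>cs\<close>.\<close>

lemma proj_same: "s \<in> S \<Longrightarrow> proj s s = 1"
  unfolding proj_def
  by (subst foldr_reflection_outside) (simp_all add: in_set_take_iff simple_root_def)

lemma proj_after: "s \<in> S \<Longrightarrow> t \<in> S \<Longrightarrow> idx s < idx t \<Longrightarrow> proj s t = 0"
  unfolding proj_def
  by (subst foldr_reflection_outside) (auto simp add: in_set_take_iff simple_root_def)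

lemma proj_nonneg: "s \<in> S \<Longrightarrow> nonneg (proj s)"
  using root_nonnegI[OF proj_root, of s s] by (simp add: proj_same)

lemma proj_inj: "s \<in> S \<Longrightarrow> t \<in> S \<Longrightarrow> proj s = proj t \<Longrightarrow> s = t"
  by (metis idx_inj linorder_neqE_nat proj_after proj_same zero_neq_one)

text \<open>A triangular splitting of the matrix of \<open>2 * B\<close>: the diagonal is halved,
  and each off-diagonal value is kept at one of the two ordered pairs only.\<close>

definition euler_coeff :: "'a \<Rightarrow> 'a \<Rightarrow> real" where
  "euler_coeff s t = (if s = t then 1 else if idx t < idx s then 2 * B (\<alpha> t) (\<alpha> s) else 0)"

text \<open>A non-symmetric form with \<open>E u v + E v u = 2 B u v\<close> for which the vectors \<^const>\<open>proj\<close> are dual to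
  the coordinates; it is the Euler form of the quiver that \<open>c\<close> defines on the Coxeter graph.\<close>

definition euler :: "('a \<Rightarrow> real) \<Rightarrow> ('a \<Rightarrow> real) \<Rightarrow> real" where
  "euler u v = (\<Sum>s\<in>S. \<Sum>t\<in>S. u s * v t * euler_coeff s t)"

lemma form_alt: "B u v = (\<Sum>s\<in>S. \<Sum>t\<in>S. u s * v t * B (\<alpha> s) (\<alpha> t))"
  by (simp add: coxeter_form_def[of _ _ u v] form_simple_roots)

lemma euler_sym: "euler u v + euler v u = 2 * B u v"
proof -
  have "euler v u = (\<Sum>s\<in>S. \<Sum>t\<in>S. u s * v t * euler_coeff t s)"
    unfolding euler_def by (subst sum.swap) (simp add: mult.commute mult.left_commute)
  then have "euler u v + euler v u =
      (\<Sum>s\<in>S. \<Sum>t\<in>S. u s * v t * (euler_coeff s t + euler_coeff t s))"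
    by (simp add: euler_def sum.distrib distrib_left)
  also have "\<dots> = (\<Sum>s\<in>S. \<Sum>t\<in>S. u s * v t * (2 * B (\<alpha> s) (\<alpha> t)))"
  proof (intro sum.cong refl arg_cong2[of _ _ _ _ "(*)"])
    fix s t assume "s \<in> S" "t \<in> S"
    then show "euler_coeff s t + euler_coeff t s = 2 * B (\<alpha> s) (\<alpha> t)"
      using idx_inj[of s t] form_commute[of "\<alpha> s" "\<alpha> t"] by (auto simp: euler_coeff_def)
  qed
  finally show ?thesis by (simp add: form_alt[of u v] sum_distrib_left mult.commute mult.left_commute)
qed

lemma euler_sum_left:
  "euler (\<lambda>x. u x - (\<Sum>t\<in>T. a t * w t x)) v = euler u v - (\<Sum>t\<in>T. a t * euler (w t) v)"
proof -
  let ?L = "\<lambda>s. \<Sum>r\<in>S. v r * euler_coeff s r"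
  have eq: "euler u v = (\<Sum>s\<in>S. u s * ?L s)" for u
    by (simp add: euler_def sum_distrib_left mult.assoc)
  have "(\<Sum>s\<in>S. (\<Sum>t\<in>T. a t * w t s) * ?L s) = (\<Sum>s\<in>S. \<Sum>t\<in>T. a t * (w t s * ?L s))"
    by (simp add: sum_distrib_right mult.assoc)
  also have "\<dots> = (\<Sum>t\<in>T. \<Sum>s\<in>S. a t * (w t s * ?L s))" by (rule sum.swap)
  also have "\<dots> = (\<Sum>t\<in>T. a t * (\<Sum>s\<in>S. w t s * ?L s))" by (simp add: sum_distrib_left)
  finally show ?thesis unfolding eq by (simp add: left_diff_distrib sum_subtractf)
qed

lemma euler_uminus_left: "euler (\<lambda>x. - u x) v = - euler u v"
  by (simp add: euler_def sum_negf)

lemma euler_simple_root: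
  assumes "s \<in> S"
  shows "euler (\<alpha> s) v = v s + (\<Sum>t\<in>{t \<in> S. idx t < idx s}. 2 * B (\<alpha> t) (\<alpha> s) * v t)"
proof -
  have "euler (\<alpha> s) v = (\<Sum>r\<in>S. if r = s then \<Sum>t\<in>S. v t * euler_coeff s t else 0)"
    unfolding euler_def by (intro sum.cong) (auto simp: simple_root_def)
  also have "\<dots> = (\<Sum>t\<in>S. v t * euler_coeff s t)" using assms by simp
  also have "\<dots> = (\<Sum>t\<in>S. (if t = s then v t else 0) +
      (if idx t < idx s then 2 * B (\<alpha> t) (\<alpha> s) * v t else 0))"
    by (intro sum.cong) (auto simp: euler_coeff_def)
  also have "\<dots> = v s + (\<Sum>t\<in>S. if idx t < idx s then 2 * B (\<alpha> t) (\<alpha> s) * v t else 0)"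
    using assms by (simp add: sum.distrib)
  finally show ?thesis by (simp add: sum.inter_filter)
qed

text \<open>\<open>euler_simple_root\<close> and \<open>proj_expansion\<close> carry the same
  triangular sum with opposite signs, so the two cancel by induction along
  \<open>cs\<close>.\<close>

lemma euler_proj: "s \<in> S \<Longrightarrow> euler (proj s) v = v s"
proof (induction "idx s" arbitrary: s rule: less_induct)
  case less
  have "euler (proj s) v =
      euler (\<lambda>x. \<alpha> s x - (\<Sum>t\<in>{t \<in> S. idx t < idx s}. 2 * B (\<alpha> t) (\<alpha> s) * proj t x)) v"
    using proj_expansion[OF less.prems] by presburger
  also have "\<dots> = euler (\<alpha> s) v -
      (\<Sum>t\<in>{t \<in> S. idx t < idx s}. 2 * B (\<alpha> t) (\<alpha> s) * euler (proj t) v)"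
    by (rule euler_sum_left)
  also have "(\<Sum>t\<in>{t \<in> S. idx t < idx s}. 2 * B (\<alpha> t) (\<alpha> s) * euler (proj t) v) =
      (\<Sum>t\<in>{t \<in> S. idx t < idx s}. 2 * B (\<alpha> t) (\<alpha> s) * v t)"
    using less.hyps by (intro sum.cong) auto
  finally show ?case using euler_simple_root[OF less.prems] by simp
qed

lemma form_expand_left: "B v u = (\<Sum>t\<in>S. v t * B (\<alpha> t) u)"
  unfolding form_alt[of v u]
proof (intro sum.cong refl)
  fix s assume s: "s \<in> S"
  have "B (\<alpha> s) u = (\<Sum>t\<in>S. u t * B (\<alpha> s) (\<alpha> t))"
    using s by (subst form_simple_root) (auto simp: form_simple_roots intro!: sum.cong)
  then show "(\<Sum>t\<in>S. v s * u t * B (\<alpha> s) (\<alpha> t)) = v s * B (\<alpha> s) u"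
    by (simp add: sum_distrib_left mult.assoc)
qed

text \<open>By \<open>rep_c\<close> and duality, passing from \<open>u\<close> to its image
  subtracts exactly \<open>2 * B v u\<close>, and \<open>euler_sym\<close> rewrites the rest. Two
  applications swap the arguments twice, which gives invariance under \<open>c\<close>.\<close>

lemma euler_c: "euler (\<rho> c u) v = - euler v u"
proof -
  have "euler (\<rho> c u) v = euler (\<lambda>x. u x - (\<Sum>t\<in>S. 2 * B (\<alpha> t) u * proj t x)) v"
    using rep_c[of u] by presburger
  also have "\<dots> = euler u v - (\<Sum>t\<in>S. 2 * B (\<alpha> t) u * euler (proj t) v)"
    by (rule euler_sum_left)
  also have "(\<Sum>t\<in>S. 2 * B (\<alpha> t) u * euler (proj t) v) = 2 * B v u"
    unfolding form_expand_left[of v u] sum_distrib_left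
    by (intro sum.cong) (simp_all add: euler_proj)
  finally show ?thesis using euler_sym[of u v] form_commute[of u v] by simp
qed

lemma euler_c_pow: "euler (\<rho> (c [^] (i::nat)) u) (\<rho> (c [^] i) v) = euler u v"
proof (induction i arbitrary: u v)
  case (Suc i)
  then show ?case by (simp add: rep_mult euler_c)
qed simp

text \<open>In the recursion for \<open>proj t\<close> no summand lowers this coordinate, and the
  one of \<open>s\<close> raises it strictly. By duality the Euler form of \<open>proj s\<close> and
  \<open>proj t\<close> is positive.\<close>

lemma proj_before_pos:
  assumes "s \<in> S" "t \<in> S" "idx s < idx t" "B (\<alpha> s) (\<alpha> t) < 0"
  shows "proj t s > 0"
proof -
  let ?T = "{r \<in> S. idx r < idx t}"
  have "(\<Sum>r\<in>?T. - (2 * B (\<alpha> r) (\<alpha> t) * proj r s)) \<ge> - (2 * B (\<alpha> s) (\<alpha> t) * proj s s)"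
  proof (rule member_le_sum)
    fix r assume "r \<in> ?T - {s}"
    then have "B (\<alpha> r) (\<alpha> t) \<le> 0" "proj r s \<ge> 0"
      using form_simple_roots_nonpos[of r t] proj_nonneg[of r] assms by (auto simp: nonneg_def)
    then show "0 \<le> - (2 * B (\<alpha> r) (\<alpha> t) * proj r s)" by (simp add: mult_nonpos_nonneg)
  qed (use assms in auto)
  moreover have "\<alpha> t s = 0" using assms by (auto simp: simple_root_def)
  ultimately show ?thesis
    using proj_expansion[OF assms(2), of s] assms by (simp add: sum_negf proj_same)
qed

lemma rep_proj:
  assumes w: "w \<in> carrier W" and s: "s \<in> S"
  shows "\<rho> w (proj s) x = \<rho> w (\<alpha> s) x -
    (\<Sum>t\<in>{t \<in> S. idx t < idx s}. 2 * B (\<alpha> t) (\<alpha> s) * \<rho> w (proj t) x)"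
proof -
  let ?T = "{t \<in> S. idx t < idx s}"
  let ?u = "\<lambda>x. \<Sum>t\<in>?T. 2 * B (\<alpha> t) (\<alpha> s) * proj t x"
  have "proj s = (\<lambda>x. 1 * \<alpha> s x + (-1) * ?u x)" using proj_expansion[OF s] by (simp add: fun_eq_iff)
  then have "\<rho> w (proj s) = \<rho> w (\<lambda>x. 1 * \<alpha> s x + (-1) * ?u x)" by (rule arg_cong)
  also have "\<dots> = (\<lambda>x. 1 * \<rho> w (\<alpha> s) x + (-1) * \<rho> w ?u x)" using w by (rule rep_linear)
  also have "\<rho> w ?u = (\<lambda>x. \<Sum>t\<in>?T. 2 * B (\<alpha> t) (\<alpha> s) * \<rho> w (proj t) x)"
    using w by (rule rep_sum) simp
  finally show ?thesis by simp
qed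

text \<open>The companion positivity for the opposite order: by duality it bounds the Euler form of
  \<open>proj t\<close> with the \<open>c\<close>-image of \<open>proj s\<close> from below,
  strictly above zero when \<open>s\<close> and \<open>t\<close> are joined.\<close>

lemma rep_c_proj_ge:
  assumes "s \<in> S" "t \<in> S" "idx s < idx t"
  shows "\<rho> c (proj s) t \<ge> - 2 * B (\<alpha> s) (\<alpha> t)"
  using assms
proof (induction "idx s" arbitrary: s rule: less_induct)
  case less
  let ?T = "{r \<in> S. idx r < idx s}"
  have 1: "2 * B (\<alpha> r) (\<alpha> s) * \<rho> c (proj r) t \<le> 0" if "r \<in> ?T" for r
  proof -
    have "- 2 * B (\<alpha> r) (\<alpha> t) \<le> \<rho> c (proj r) t" using less that by auto
    moreover have "B (\<alpha> r) (\<alpha> t) \<le> 0" "B (\<alpha> r) (\<alpha> s) \<le> 0"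
      using that less.prems by (auto intro!: form_simple_roots_nonpos)
    ultimately show ?thesis by (simp add: mult_nonpos_nonneg)
  qed
  have 2: "0 \<le> - (2 * B (\<alpha> r) (\<alpha> s) * proj r t)" if "r \<in> S" for r
  \<comment> \<open>Only \<open>r = s\<close> has a positive form value, and there the coordinate
    vanishes because \<open>s\<close> precedes \<open>t\<close>.\<close>
  proof (cases "r = s")
    case True
    then show ?thesis using proj_after less.prems by simp
  next
    case False
    then show ?thesis
      using form_simple_roots_nonpos[of r s] proj_nonneg[of r] that less.prems
      by (simp add: nonneg_def mult_nonpos_nonneg)
  qed
  have "(\<Sum>r\<in>S. - (2 * B (\<alpha> r) (\<alpha> s) * proj r t)) \<ge> - (2 * B (\<alpha> t) (\<alpha> s) * proj t t)"
    using 2 less.prems by (intro member_le_sum) auto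
  moreover have "\<alpha> s t = 0" using less.prems by (auto simp: simple_root_def)
  ultimately have "\<rho> c (\<alpha> s) t \<ge> - 2 * B (\<alpha> s) (\<alpha> t)"
    using rep_c[of "\<alpha> s" t] less.prems form_commute[of "\<alpha> s" "\<alpha> t"]
    by (simp add: sum_negf proj_same)
  moreover have "(\<Sum>r\<in>?T. 2 * B (\<alpha> r) (\<alpha> s) * \<rho> c (proj r) t) \<le> 0"
    using 1 by (rule sum_nonpos)
  ultimately show ?case using rep_proj[OF c_closed less.prems(1), of t] by simp
qed

text \<open>Coordinates other than that of \<open>s\<close> are untouched, so a positive one among
  them would keep the image positive. Thus the root is a multiple of \<open>\<alpha> s\<close>, and
  norm one fixes the factor.\<close>

lemma reflection_changes_sign:
  assumes "\<beta> \<in> roots" "nonneg \<beta>" "s \<in> S" "\<not> nonneg (\<sigma> s \<beta>)"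
  shows "\<beta> = \<alpha> s"
proof -
  have root: "\<sigma> s \<beta> \<in> roots" using rep_root[of s \<beta>] assms by (simp add: rep_generator)
  have zero: "\<beta> x = 0" if "x \<noteq> s" for x
  proof (rule ccontr)
    assume "\<beta> x \<noteq> 0"
    then have "\<beta> x > 0" using assms(2) by (simp add: nonneg_def less_le)
    then have "\<sigma> s \<beta> x > 0" using that by (simp add: simple_reflection_def simple_root_def)
    then show False using root_nonnegI[OF root] assms by blast
  qed
  then have \<beta>: "\<beta> = (\<lambda>x. \<beta> s * \<alpha> s x + 0 * \<alpha> s x)" by (auto simp: fun_eq_iff simple_root_def)
  have "B \<beta> \<beta> = B (\<lambda>x. \<beta> s * \<alpha> s x + 0 * \<alpha> s x) (\<lambda>x. \<beta> s * \<alpha> s x + 0 * \<alpha> s x)"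
    using \<beta> by simp
  also have "\<dots> = \<beta> s * \<beta> s" unfolding form_linear_left form_linear_right using assms by simp
  finally have "\<beta> s * \<beta> s = 1" using root_norm[OF assms(1)] by simp
  moreover have "\<beta> s \<ge> 0" using assms by (simp add: nonneg_def)
  ultimately have "\<beta> s = 1" using square_eq_1_iff[of "\<beta> s"] by auto
  then show ?thesis using \<beta> by simp
qed

text \<open>Undo the letters of \<open>c\<close> one at a time: at a step where the sign changes,
  the root must be the simple root of that letter, and going back through the prefix gives its
  \<open>proj\<close>.\<close>

lemma inversion_of_c:
  assumes "\<beta> \<in> roots" "nonneg \<beta>" "nonpos (\<rho> (inv c) \<beta>)"
  shows "\<exists>s\<in>S. \<beta> = proj s"
proof -
  define \<gamma> where "\<gamma> = (\<lambda>m. foldr \<sigma> (rev (take m cs)) \<beta>)"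
  have rl: "rev (take m cs) \<in> lists S" for m using take_in_lists[of m] by (simp add: in_lists_conv_set)
  have rep: "\<gamma> m = \<rho> (inv (wp (take m cs))) \<beta>" for m
    unfolding \<gamma>_def using rep_word[OF rl[of m]] word_prod_rev[OF take_in_lists[of m]] by simp
  have tc: "wp (take m cs) \<in> carrier W" for m using take_in_lists by (rule word_prod_closed)
  have root: "\<gamma> m \<in> roots" for m unfolding rep using assms tc rep_root by simp
  have "\<not> nonneg (\<gamma> (length cs))"
    using assms root[of "length cs"] root_sign by (simp add: rep)
  moreover have "nonneg (\<gamma> 0)" using assms by (simp add: \<gamma>_def)
  ultimately obtain m where m: "m < length cs" "nonneg (\<gamma> m)" "\<not> nonneg (\<gamma> (Suc m))"
    using dec_induct[of 0 "length cs" "\<lambda>m. nonneg (\<gamma> m)"] by blast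
  have "\<gamma> (Suc m) = \<sigma> (cs ! m) (\<gamma> m)" using m by (simp add: \<gamma>_def take_Suc_conv_app_nth)
  then have "\<gamma> m = \<alpha> (cs ! m)" using reflection_changes_sign[OF root[of m]] m by simp
  then have "\<beta> = \<rho> (wp (take m cs)) (\<alpha> (cs ! m))" unfolding rep using tc by (metis rep_inv_cancel(2))
  also have "\<dots> = proj (cs ! m)" using m rep_word[OF take_in_lists] by (simp add: proj_def)
  finally show ?thesis using m nth_in by blast
qed

text \<open>\<open>euler_c\<close> together with duality computes the coordinate at \<open>s\<close>
  as -1, and one negative coordinate decides.\<close>

lemma rep_inv_c_proj:
  assumes "s \<in> S"
  shows "nonpos (\<rho> (inv c) (proj s))"
proof -
  have "euler (proj s) (proj s) = - euler (proj s) (\<rho> (inv c) (proj s))"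
    using euler_c[of "\<rho> (inv c) (proj s)" "proj s"] by simp
  then have "\<rho> (inv c) (proj s) s = -1" using assms by (simp add: euler_proj proj_same)
  then have "\<not> nonneg (\<rho> (inv c) (proj s))" by (auto simp: nonneg_def intro!: exI[of _ s])
  then show ?thesis using assms root_sign rep_root proj_root by simp
qed

text \<open>The sum over a \<open>c\<close>-orbit is fixed by \<open>c\<close>, hence by every generator and by \<open>w\<^sub>0\<close>, which negates
  nonnegative vectors up to a permutation of the coordinates.\<close>

lemma orbit_becomes_nonpos:
  assumes "\<beta> \<in> roots"
  shows "\<exists>i::nat. nonpos (\<rho> (c [^] i) \<beta>)"
proof (rule ccontr)
  assume "\<not> ?thesis"
  then have pos: "nonneg (\<rho> (c [^] i) \<beta>)" for i :: nat
    using root_sign[OF rep_root[OF _ assms]] by (metis c_closed nat_pow_closed)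
  define m where "m = ord c"
  have m: "m > 0" "c [^] m = \<one>"
    using ord_ge_1[OF finite_carrier, of c] pow_ord_eq_1[of c] by (auto simp: m_def)
  define v where "v = (\<lambda>x. \<Sum>i<m. 1 * \<rho> (c [^] i) \<beta> x)"
  have "\<rho> c v = (\<lambda>x. \<Sum>i<m. 1 * \<rho> c (\<rho> (c [^] i) \<beta>) x)"
    unfolding v_def by (rule rep_sum) simp_all
  also have "\<dots> = v"
  proof
    fix x
    define f where "f = (\<lambda>i::nat. \<rho> (c [^] i) \<beta> x)"
    have "\<rho> c (\<rho> (c [^] i) \<beta>) = \<rho> (c [^] Suc i) \<beta>" for i :: nat
      using nat_pow_Suc2[of c i] by (simp add: rep_mult)
    then have "(\<Sum>i<m. 1 * \<rho> c (\<rho> (c [^] i) \<beta>) x) = (\<Sum>i<m. f (Suc i))" by (simp only: f_def mult_1)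
    also have "\<dots> = (\<Sum>i<m. f i)"
      using sum.lessThan_Suc_shift[of f m] sum.lessThan_Suc[of f m] m by (simp add: f_def)
    finally show "(\<Sum>i<m. 1 * \<rho> c (\<rho> (c [^] i) \<beta>) x) = v x" by (simp add: v_def f_def)
  qed
  finally have fixed: "\<rho> c v = v" .
  then have zero: "(\<Sum>t\<in>S. 2 * B (\<alpha> t) v * proj t x) = 0" for x using rep_c[of v x] by simp
  \<comment> \<open>Pairing the vanishing combination of the \<open>proj t\<close> with
    \<open>\<alpha> s\<close> under the Euler form isolates the coefficient of
    \<open>proj s\<close>.\<close>
  have form: "B (\<alpha> s) v = 0" if "s \<in> S" for s
  proof -
    have "euler (\<lambda>x. 0 - (\<Sum>t\<in>S. 2 * B (\<alpha> t) v * proj t x)) (\<alpha> s) =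
        euler (\<lambda>x. 0) (\<alpha> s) - (\<Sum>t\<in>S. 2 * B (\<alpha> t) v * euler (proj t) (\<alpha> s))"
      by (rule euler_sum_left)
    then have "(\<Sum>t\<in>S. 2 * B (\<alpha> t) v * \<alpha> s t) = 0"
      by (simp add: zero euler_proj)
    moreover have "(\<Sum>t\<in>S. 2 * B (\<alpha> t) v * \<alpha> s t) = (\<Sum>t\<in>S. if t = s then 2 * B (\<alpha> t) v else 0)"
      by (intro sum.cong) (auto simp: simple_root_def)
    ultimately show ?thesis using that by simp
  qed
  have "foldr \<sigma> ws v = v" if "ws \<in> lists S" for ws
    using that by (induction ws) (simp_all add: simple_reflection_def form)
  then have w0: "\<rho> w\<^sub>0 v = v"
    using word_exists[OF longest_closed] rep_word by metis
  obtain x where x: "x \<in> S" "\<beta> x \<noteq> 0" using root_nonzero[OF assms] by blast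
  have out: "v y = 0" if "y \<notin> S" for y
    unfolding v_def using root_outside[OF rep_root[OF _ assms] that] by simp
  have nn: "v y \<ge> 0" for y unfolding v_def using pos by (simp add: nonneg_def sum_nonneg)
  have "v x = - v (\<psi> x)" using rep_longest[of v x] out x w0 by simp
  then have "v x = 0" using nn[of x] nn[of "\<psi> x"] by simp
  moreover have "\<rho> (c [^] (0::nat)) \<beta> x \<le> (\<Sum>i<m. \<rho> (c [^] i) \<beta> x)"
    using m pos by (intro member_le_sum) (auto simp: nonneg_def)
  ultimately have "\<beta> x \<le> 0" by (simp add: v_def)
  moreover have "\<beta> x \<ge> 0" using pos[of 0] by (simp add: nonneg_def)
  ultimately show False using x by simp
qed

end

section \<open>Inversions of reduced words\<close>

context finite_coxeter_system
begin

lemma foldr_rev_cancel: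
  assumes "ws \<in> lists S"
  shows "foldr \<sigma> (rev ws) (foldr \<sigma> ws v) = v"
  using assms by (induction ws arbitrary: v) (auto simp: reflection_involution)

lemma foldr_reflection_uminus: "foldr \<sigma> ws (\<lambda>x. - v x) = (\<lambda>x. - foldr \<sigma> ws v x)"
  using foldr_reflection_linear[of ws "-1" v 0 v] by simp

lemma reduced_prefix:
  assumes "us @ vs \<in> lists S" "len (wp (us @ vs)) = length (us @ vs)"
  shows "len (wp us) = length us"
proof -
  have l: "us \<in> lists S" "vs \<in> lists S" using assms by auto
  then have "len (wp (us @ vs)) \<le> len (wp us) + len (wp vs)"
    using word_prod_append[OF l] length_mult_le[OF word_prod_closed word_prod_closed] by simp
  then show ?thesis using length_word_ge[OF l(1)] length_word_ge[OF l(2)] assms by simp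
qed

text \<open>The reversed word is reduced as well, hence so is its prefix ending in \<open>s\<close>.
  The root of that prefix is nonnegative, and the letter \<open>s\<close> itself contributes the
  minus sign.\<close>

lemma reduced_inversion:
  assumes l: "us @ s # vs \<in> lists S" and red: "len (wp (us @ s # vs)) = length (us @ s # vs)"
  shows "nonpos (\<rho> (inv (wp (us @ s # vs))) (foldr \<sigma> us (\<alpha> s)))"
proof -
  have s: "s \<in> S" and us: "us \<in> lists S" and vs: "rev vs \<in> lists S" using l by auto
  have r: "rev (us @ s # vs) \<in> lists S" using l unfolding in_lists_conv_set by auto
  have "len (wp (rev (us @ s # vs))) = length (rev (us @ s # vs))"
    using red word_prod_rev[OF l] length_inv[OF word_prod_closed[OF l]] by simp
  moreover have "rev (us @ s # vs) = (rev vs @ [s]) @ rev us" by simp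
  ultimately have "len (wp (rev vs @ [s])) = length (rev vs @ [s])"
    using reduced_prefix[of "rev vs @ [s]" "rev us"] r by metis
  then have "nonneg (foldr \<sigma> (rev vs) (\<alpha> s))" using reduced_snoc[OF vs s] by simp
  moreover have "\<rho> (inv (wp (us @ s # vs))) (foldr \<sigma> us (\<alpha> s)) =
      foldr \<sigma> (rev (us @ s # vs)) (foldr \<sigma> us (\<alpha> s))"
    using word_prod_rev[OF l] rep_word[OF r] by simp
  ultimately show ?thesis
    using s us by (simp add: foldr_rev_cancel reflection_simple_root foldr_reflection_uminus)
qed

lemma rep_longest_nonpos:
  assumes "\<beta> \<in> roots" "nonneg \<beta>"
  shows "nonpos (\<rho> w\<^sub>0 \<beta>)"
proof -
  have "\<rho> w\<^sub>0 \<beta> x \<le> 0" for x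
  proof (cases "x \<in> S")
    case True
    then show ?thesis using rep_longest[of \<beta> x] root_outside[OF assms(1)] assms(2)
      by (simp add: nonneg_def)
  next
    case False
    then show ?thesis using rep_outside[of w\<^sub>0 x \<beta>] root_outside[OF assms(1)] by simp
  qed
  then show ?thesis by (simp add: nonpos_def)
qed

lemma generator_commute_word:
  assumes "ws \<in> lists S" "t \<in> S" "\<And>r. r \<in> set ws \<Longrightarrow> r \<otimes> t = t \<otimes> r"
  shows "wp ws \<otimes> t = t \<otimes> wp ws"
  using assms
proof (induction ws)
  case (Cons r ws)
  then have cl: "r \<in> S" "wp ws \<in> carrier W" "t \<in> S" by auto
  have "wp (r # ws) \<otimes> t = r \<otimes> (wp ws \<otimes> t)" using cl by (simp add: m_assoc)
  also have "wp ws \<otimes> t = t \<otimes> wp ws" using Cons.IH Cons.prems by simp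
  also have "r \<otimes> (t \<otimes> wp ws) = r \<otimes> t \<otimes> wp ws" using cl by (simp only: m_assoc generator_closed)
  also have "\<dots> = t \<otimes> r \<otimes> wp ws" using Cons by simp
  finally show ?case using cl by (simp add: m_assoc)
qed simp

lemma foldr_fixes:
  "(\<And>r. r \<in> set ws \<Longrightarrow> \<sigma> r v = v) \<Longrightarrow> foldr \<sigma> ws v = v"
  by (induction ws) auto

end

section \<open>When a \<open>c\<close>-orbit of roots turns negative\<close>

context coxeter_word
begin

definition orb :: "'a \<Rightarrow> nat \<Rightarrow> 'a \<Rightarrow> real" where
  "orb s i = \<rho> (c [^] i) (proj s)"

lemma orb_0 [simp]: "orb s 0 = proj s"
  by (simp add: orb_def)

lemma rep_c_pow_orb: "\<rho> (c [^] j) (orb s i) = orb s (j + i)"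
  by (simp add: orb_def nat_pow_mult[symmetric] rep_mult)

lemma rep_c_orb: "\<rho> c (orb s i) = orb s (Suc i)"
  using rep_c_pow_orb[of 1 s i] by simp

lemma rep_inv_c_orb: "\<rho> (inv c) (orb s (Suc i)) = orb s i"
  by (simp flip: rep_c_orb)

lemma orb_root: "s \<in> S \<Longrightarrow> orb s i \<in> roots"
  by (simp add: orb_def rep_root proj_root)

lemma euler_orb: "euler (orb s (k + i)) (orb t (k + j)) = euler (orb s i) (orb t j)"
  unfolding rep_c_pow_orb[symmetric] by (rule euler_c_pow)

text \<open>\<open>num s\<close> turns out to be the number of letters \<open>s\<close> in the sorting word of \<open>w\<^sub>0\<close>.\<close>

definition num :: "'a \<Rightarrow> nat" where
  "num s = (LEAST i. nonpos (orb s i))"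

lemma num_nonpos: "s \<in> S \<Longrightarrow> nonpos (orb s (num s))"
  unfolding num_def using orbit_becomes_nonpos[OF proj_root] by (metis LeastI_ex orb_def)

lemma num_le: "nonpos (orb s i) \<Longrightarrow> num s \<le> i"
  unfolding num_def by (rule Least_le)

lemma orb_nonneg: "s \<in> S \<Longrightarrow> i < num s \<Longrightarrow> nonneg (orb s i)"
  using num_le[of s i] root_sign[OF orb_root] by force

lemma num_pos: "s \<in> S \<Longrightarrow> num s > 0"
  using num_nonpos[of s] proj_nonneg[of s] root_sign[OF proj_root, of s] by (cases "num s") auto

text \<open>The negative of the first negative orbit root is a positive root that
  \<open>inv c\<close> makes negative, so \<open>inversion_of_c\<close> identifies it.\<close>

lemma orb_num_ex:
  assumes "s \<in> S"
  shows "\<exists>t\<in>S. orb s (num s) = (\<lambda>x. - proj t x)"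
proof -
  obtain i where i: "num s = Suc i" using num_pos[OF assms] by (cases "num s") auto
  let ?\<gamma> = "\<lambda>x. - orb s (num s) x"
  have "?\<gamma> \<in> roots" using uminus_root orb_root assms by blast
  moreover have "nonneg ?\<gamma>" using num_nonpos[OF assms] by simp
  moreover have "nonpos (\<rho> (inv c) ?\<gamma>)"
    using orb_nonneg[OF assms, of i] by (simp add: i rep_uminus rep_inv_c_orb)
  ultimately obtain t where "t \<in> S" "?\<gamma> = proj t" using inversion_of_c by blast
  then show ?thesis by (metis minus_minus)
qed

text \<open>A provisional name for the endpoint of an orbit; \<open>phi_eq_psi\<close> identifies it
  once the sorting word is known.\<close>

definition phi :: "'a \<Rightarrow> 'a" where
  "phi s = (SOME t. t \<in> S \<and> orb s (num s) = (\<lambda>x. - proj t x))"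

lemma phi_closed: "s \<in> S \<Longrightarrow> phi s \<in> S"
  and orb_num: "s \<in> S \<Longrightarrow> orb s (num s) = (\<lambda>x. - proj (phi s) x)"
  using someI_ex[OF orb_num_ex[unfolded Bex_def]] by (auto simp: phi_def)

text \<open>The predecessor of a \<open>proj\<close> under \<open>c\<close> is negative, whereas all
  orbit roots with index below \<open>num t\<close> are positive.\<close>

lemma orb_neq_proj:
  assumes "s \<in> S" "t \<in> S" "0 < i" "i \<le> num t"
  shows "orb t i \<noteq> proj s"
proof
  assume eq: "orb t i = proj s"
  obtain j where j: "i = Suc j" using assms by (cases i) auto
  have "nonpos (orb t j)" using rep_inv_c_orb[of t j] rep_inv_c_proj[OF assms(1)] eq j by simp
  then show False using num_le[of t j] assms j by simp
qed

lemma phi_inj: "inj_on phi S"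
proof -
  have *: "s = t" if "s \<in> S" "t \<in> S" "phi s = phi t" "num s \<le> num t" for s t
  proof -
    \<comment> \<open>With equal endpoints, cancelling the smaller power of \<open>c\<close> makes
      \<open>proj s\<close> reappear inside the orbit of \<open>t\<close>.\<close>
    have "orb s (num s) = orb t (num t)" using that orb_num by simp
    then have "\<rho> (c [^] num s) (orb s 0) = \<rho> (c [^] num s) (orb t (num t - num s))"
      using that by (simp only: rep_c_pow_orb) simp
    then have "proj s = orb t (num t - num s)"
      by (metis c_closed nat_pow_closed orb_0 rep_inv_cancel(1))
    then show ?thesis
      using orb_neq_proj[of s t "num t - num s"] proj_inj that by (cases "num t = num s") auto
  qed
  show ?thesis by (rule inj_onI) (metis * nat_le_linear)
qed

text \<open>Apply \<open>inv c\<close> until the root turns negative for the first time; the last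
  positive root on the way is an inversion of \<open>c\<close>, that is, some
  \<open>proj s\<close>.\<close>

lemma positive_root_orb:
  assumes "\<gamma> \<in> roots" "nonneg \<gamma>"
  shows "\<exists>s\<in>S. \<exists>i<num s. \<gamma> = orb s i"
proof -
  have pc: "c [^] i \<in> carrier W" for i :: nat by simp
  obtain i :: nat where i: "nonpos (\<rho> (c [^] i) \<gamma>)" using orbit_becomes_nonpos[OF assms(1)] by blast
  \<comment> \<open>This exponent makes \<open>inv (c [^] k)\<close> equal to
    \<open>c [^] i\<close>, so forward negativity also yields backward negativity.\<close>
  define k where "k = (ord c - 1) * i"
  have "c [^] i \<otimes> c [^] k = c [^] (ord c * i)"
    using ord_ge_1[OF finite_carrier, of c] by (simp add: nat_pow_mult k_def diff_mult_distrib)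
  also have "\<dots> = \<one>" by (simp add: nat_pow_pow[symmetric])
  finally have "inv (c [^] k) = c [^] i" by (intro inv_equality) simp_all
  with i have ex: "\<exists>j::nat. nonpos (\<rho> (inv (c [^] j)) \<gamma>)" by metis
  define j where "j = (LEAST j::nat. nonpos (\<rho> (inv (c [^] j)) \<gamma>))"
  have j: "nonpos (\<rho> (inv (c [^] j)) \<gamma>)" unfolding j_def using ex by (rule LeastI_ex)
  have less: "nonneg (\<rho> (inv (c [^] k)) \<gamma>)" if "k < j" for k
    using not_less_Least[OF that[unfolded j_def]] root_sign[OF rep_root[OF inv_closed[OF pc] assms(1)]]
    by blast
  have "j \<noteq> 0" using j assms root_sign by (auto intro: ccontr)
  then obtain l where l: "j = Suc l" by (cases j) auto
  let ?\<delta> = "\<rho> (inv (c [^] l)) \<gamma>"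
  have "inv (c [^] j) = inv c \<otimes> inv (c [^] l)" unfolding l by (simp add: inv_mult_group)
  then have "nonpos (\<rho> (inv c) ?\<delta>)" using j by (simp add: rep_mult)
  then obtain s where s: "s \<in> S" "?\<delta> = proj s"
    using inversion_of_c[of ?\<delta>] less[of l] l rep_root assms by auto
  then have \<gamma>: "\<gamma> = orb s l" unfolding orb_def by (metis pc rep_inv_cancel(2))
  have "\<not> num s \<le> l"
  proof
    assume le: "num s \<le> l"
    have "\<rho> (inv (c [^] (l - num s))) (orb s l) = orb s (num s)"
      using rep_c_pow_orb[of "l - num s" s "num s"] le by (metis le_add_diff_inverse2 pc rep_inv_cancel(1))
    then have "nonneg (orb s (num s))" using less[of "l - num s"] \<gamma> l by simp
    then show False using num_nonpos[OF s(1)] root_sign[OF orb_root[OF s(1)]] by blast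
  qed
  then show ?thesis using s(1) \<gamma> not_le by blast
qed

text \<open>The first bound transports the positive Euler value of \<open>proj s\<close> and
  \<open>proj t\<close>, the second that of \<open>proj t\<close> and the \<open>c\<close>-image of
  \<open>proj s\<close>, until the first argument becomes minus some \<open>proj\<close>. The second
  argument is then negative.\<close>

lemma num_adjacent:
  assumes "s \<in> S" "t \<in> S" "idx s < idx t" "B (\<alpha> s) (\<alpha> t) < 0"
  shows "num t \<le> num s" "num s \<le> Suc (num t)"
proof -
  have "euler (orb s (num s)) (orb t (num s)) > 0"
    using euler_orb[of s "num s" 0 t 0] proj_before_pos[OF assms] assms by (simp add: euler_proj)
  then have "orb t (num s) (phi s) < 0"
    using assms phi_closed by (simp add: orb_num euler_uminus_left euler_proj)
  then have "\<not> nonneg (orb t (num s))" by (auto simp: nonneg_def not_le intro: exI[of _ "phi s"])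
  then show "num t \<le> num s" using num_le root_sign[OF orb_root] assms by blast
  have "euler (orb t (num t)) (orb s (Suc (num t))) > 0"
    using euler_orb[of t "num t" 0 s 1] rep_c_proj_ge[OF assms(1-3)] rep_c_orb[of s 0] assms
    by (simp add: euler_proj)
  then have "orb s (Suc (num t)) (phi t) < 0"
    using assms phi_closed by (simp add: orb_num euler_uminus_left euler_proj)
  then have "\<not> nonneg (orb s (Suc (num t)))" by (auto simp: nonneg_def not_le intro: exI[of _ "phi t"])
  then show "num s \<le> Suc (num t)" using num_le root_sign[OF orb_root] assms by blast
qed

end

section \<open>Sorting words\<close>

locale irreducible_coxeter_word = coxeter_word +
  assumes irreducible: "coxeter_irreducible W S"
begin

abbreviation "n \<equiv> length cs"

lemma cs_nonempty [simp]: "cs \<noteq> []"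
  using irreducible set_cs by (auto simp: coxeter_irreducible_def)

lemma mod_n_less [simp]: "p mod n < n"
  by simp

definition letter :: "nat \<Rightarrow> 'a" where
  "letter p = cs ! (p mod n)"

definition taken :: "nat \<Rightarrow> bool" where
  "taken p \<longleftrightarrow> p div n < num (letter p)"

definition position :: "'a \<Rightarrow> nat \<Rightarrow> nat" where
  "position s i = i * n + idx s"

definition full :: "nat \<Rightarrow> 'a list" where
  "full p = map letter [0..<p]"

definition tk :: "nat \<Rightarrow> 'a list" where
  "tk p = map letter (filter taken [0..<p])"

definition sk :: "nat \<Rightarrow> 'a list" where
  "sk p = map letter (filter (\<lambda>q. \<not> taken q) [0..<p])"

lemma letter_in [simp]: "letter p \<in> S"
  by (simp add: letter_def)

lemma idx_letter [simp]: "idx (letter p) = p mod n"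
  by (simp add: letter_def)

lemma position_letter: "position (letter p) (p div n) = p"
  by (simp add: position_def)

lemma letter_position [simp]: "s \<in> S \<Longrightarrow> letter (position s i) = s"
  by (simp add: position_def letter_def)

lemma position_div [simp]: "s \<in> S \<Longrightarrow> position s i div n = i"
  by (simp add: position_def)

lemma taken_position: "s \<in> S \<Longrightarrow> taken (position s i) \<longleftrightarrow> i < num s"
  by (simp add: taken_def)

lemma map_letter_in_lists: "map letter ps \<in> lists S"
  by (auto simp: in_lists_conv_set)

lemma full_block: "j \<le> n \<Longrightarrow> full (i * n + j) = full (i * n) @ take j cs"
proof -
  assume j: "j \<le> n"
  have "map letter [i * n..<i * n + j] = take j cs"
    using j by (intro nth_equalityI) (auto simp: letter_def)
  then show ?thesis
    unfolding full_def by (subst upt_add_eq_append) auto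
qed

lemma word_prod_full_block: "wp (full (i * n)) = c [^] i"
proof (induction i)
  case 0
  then show ?case by (simp add: full_def)
next
  case (Suc i)
  have "full (Suc i * n) = full (i * n) @ cs" using full_block[of n i] by (simp add: add.commute)
  moreover have "full (i * n) \<in> lists S" unfolding full_def by (rule map_letter_in_lists)
  ultimately show ?case using Suc.IH word_prod_append[of "full (i * n)" cs] by simp
qed

text \<open>Complete blocks multiply to a power of \<open>c\<close>, and the incomplete block turns
  the simple root into its \<open>proj\<close>. This ties positions of the periodic word to orbit
  roots.\<close>

lemma full_root: "foldr \<sigma> (full p) (\<alpha> (letter p)) = orb (letter p) (p div n)"
proof -
  have l: "full q \<in> lists S" for q unfolding full_def by (rule map_letter_in_lists)
  have "full p = full (p div n * n) @ take (p mod n) cs"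
    using full_block[of "p mod n" "p div n"] mod_n_less[of p] by simp
  then have "foldr \<sigma> (full p) (\<alpha> (letter p)) = foldr \<sigma> (full (p div n * n)) (proj (letter p))"
    by (simp add: proj_def)
  also have "\<dots> = \<rho> (c [^] (p div n)) (proj (letter p))"
    using rep_word[OF l] word_prod_full_block by metis
  finally show ?thesis by (simp add: orb_def)
qed

text \<open>A skipped letter has used up its copies while a later taken one has not. For joined
  letters this contradicts \<open>num_adjacent\<close>.\<close>

lemma skipped_taken:
  assumes "q < p" "\<not> taken q" "taken p"
  shows "letter q \<noteq> letter p" "coxeter_m W (letter q) (letter p) = 2"
proof -
  have le: "q div n \<le> p div n" using assms by (simp add: div_le_mono)
  have q: "num (letter q) \<le> q div n" and p: "p div n < num (letter p)"
    using assms by (auto simp: taken_def)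
  show neq: "letter q \<noteq> letter p" using le q p by auto
  show "coxeter_m W (letter q) (letter p) = 2"
  proof (rule ccontr)
    assume "coxeter_m W (letter q) (letter p) \<noteq> 2"
    then have neg: "B (\<alpha> (letter q)) (\<alpha> (letter p)) < 0" "B (\<alpha> (letter p)) (\<alpha> (letter q)) < 0"
      using form_simple_roots_neg[of "letter q" "letter p"] neq form_commute by auto
    show False
    proof (cases "idx (letter q) < idx (letter p)")
      case True
      then show False using num_adjacent(1)[OF _ _ True neg(1)] le q p by simp
    next
      case False
      then have l: "idx (letter p) < idx (letter q)" using idx_inj[of "letter q" "letter p"] neq by force
      \<comment> \<open>Here \<open>q\<close> comes later within its block but earlier overall, so
        its block is strictly earlier; this absorbs the extra 1 in the second bound.\<close>
      have "q div n \<noteq> p div n"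
        using l assms(1) by (metis div_mult_mod_eq idx_letter nat_add_left_cancel_less not_less_iff_gr_or_eq)
      then show False using num_adjacent(2)[OF _ _ l neg(2)] le q p by simp
    qed
  qed
qed

lemma skipped_commute:
  assumes "q < p" "\<not> taken q" "taken p"
  shows "letter q \<otimes> letter p = letter p \<otimes> letter q"
  using coxeter_m_two_commute skipped_taken(2)[OF assms] by simp

lemma skipped_form_zero:
  assumes "q < p" "\<not> taken q" "taken p"
  shows "B (\<alpha> (letter q)) (\<alpha> (letter p)) = 0"
  using form_simple_roots_zero skipped_taken(2)[OF assms] by simp

lemma set_sk: "r \<in> set (sk p) \<longleftrightarrow> (\<exists>q<p. \<not> taken q \<and> r = letter q)"
  by (auto simp: sk_def)

lemma sk_in_lists [simp]: "sk p \<in> lists S" and tk_in_lists [simp]: "tk p \<in> lists S"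
  unfolding sk_def tk_def by (rule map_letter_in_lists)+

lemma sk_closed: "wp (sk p) \<in> carrier W" and tk_closed: "wp (tk p) \<in> carrier W"
  using sk_in_lists tk_in_lists word_prod_closed by blast+

lemma sk_commute:
  assumes "p \<le> q" "taken q"
  shows "wp (sk p) \<otimes> letter q = letter q \<otimes> wp (sk p)"
proof (rule generator_commute_word)
  fix r assume "r \<in> set (sk p)"
  then obtain q' where "q' < q" "\<not> taken q'" "r = letter q'"
    using assms(1) less_le_trans unfolding set_sk by blast
  then show "r \<otimes> letter q = letter q \<otimes> r" using assms skipped_commute by blast
qed simp_all

lemma word_prod_full: "wp (full p) = wp (tk p) \<otimes> wp (sk p)"
proof (induction p)
  case 0
  then show ?case by (simp add: full_def tk_def sk_def)
next
  case (Suc p)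
  have l: "full p \<in> lists S" unfolding full_def by (rule map_letter_in_lists)
  have "wp (full (Suc p)) = wp (full p) \<otimes> letter p"
    using word_prod_append[OF l, of "[letter p]"] by (simp add: full_def)
  also have "\<dots> = wp (tk p) \<otimes> (wp (sk p) \<otimes> letter p)"
    unfolding Suc.IH using sk_closed tk_closed by (simp add: m_assoc)
  also have "\<dots> = wp (tk (Suc p)) \<otimes> wp (sk (Suc p))"
  proof (cases "taken p")
    case True
    have "wp (tk (Suc p)) = wp (tk p) \<otimes> letter p"
      using True word_prod_append[OF tk_in_lists, of "[letter p]" p] by (simp add: tk_def)
    moreover have "sk (Suc p) = sk p" using True by (simp add: sk_def)
    ultimately show ?thesis
      using sk_commute[of p p] True sk_closed tk_closed by (simp add: m_assoc)
  next
    case False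
    have "wp (sk (Suc p)) = wp (sk p) \<otimes> letter p"
      using False word_prod_append[OF sk_in_lists, of "[letter p]" p] by (simp add: sk_def)
    moreover have "tk (Suc p) = tk p" using False by (simp add: tk_def)
    ultimately show ?thesis by simp
  qed
  finally show ?case .
qed

lemma orb_factorization:
  "orb (letter p) (p div n) = \<rho> (wp (tk p)) (foldr \<sigma> (sk p) (\<alpha> (letter p)))"
proof -
  have l: "full p \<in> lists S" unfolding full_def by (rule map_letter_in_lists)
  have "orb (letter p) (p div n) = \<rho> (wp (full p)) (\<alpha> (letter p))"
    using full_root rep_word[OF l] by simp
  also have "\<dots> = \<rho> (wp (tk p)) (\<rho> (wp (sk p)) (\<alpha> (letter p)))"
    unfolding word_prod_full using sk_closed tk_closed by (rule rep_mult[rotated])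
  finally show ?thesis using rep_word[OF sk_in_lists] by simp
qed

text \<open>The letters skipped before a taken position are orthogonal to its simple root, so
  deleting them leaves the root unchanged. The inversions of the taken word are thus orbit roots
  that are still positive.\<close>

lemma taken_root:
  assumes "taken p"
  shows "foldr \<sigma> (tk p) (\<alpha> (letter p)) = orb (letter p) (p div n)"
proof -
  have "foldr \<sigma> (sk p) (\<alpha> (letter p)) = \<alpha> (letter p)"
    by (rule foldr_fixes) (use assms skipped_form_zero in \<open>auto simp: set_sk simple_reflection_def\<close>)
  then show ?thesis using orb_factorization[of p] rep_word[OF tk_in_lists] by simp
qed

lemma tk_Suc: "tk (Suc p) = tk p @ (if taken p then [letter p] else [])"
  by (simp add: tk_def)

lemma tk_reduced: "len (wp (tk p)) = length (tk p)"
proof (induction p)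
  case 0
  then show ?case by (simp add: tk_def)
next
  case (Suc p)
  show ?case
  proof (cases "taken p")
    case True
    then have "nonneg (foldr \<sigma> (tk p) (\<alpha> (letter p)))"
      using taken_root orb_nonneg[of "letter p" "p div n"] by (simp add: taken_def)
    then show ?thesis
      using reduced_snoc[OF tk_in_lists letter_in, of p p] Suc True by (simp add: tk_Suc)
  next
    case False
    then show ?thesis using Suc by (simp add: tk_Suc)
  qed
qed

text \<open>Enough blocks to contain every taken position and also the first skipped copy of each
  letter, which is used in \<open>rep_longest_orb_num\<close>.\<close>

definition K :: nat where
  "K = Suc (\<Sum>s\<in>S. num s) * n"

lemma position_less_K: "s \<in> S \<Longrightarrow> i \<le> num s \<Longrightarrow> position s i < K"
proof -
  assume s: "s \<in> S" "i \<le> num s"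
  then have "i \<le> (\<Sum>s\<in>S. num s)" using member_le_sum[of s S num] by simp
  then have "i * n \<le> (\<Sum>s\<in>S. num s) * n" by (rule mult_le_mono1)
  moreover have "K = n + (\<Sum>s\<in>S. num s) * n" "position s i = i * n + idx s"
    by (simp_all add: K_def position_def)
  ultimately show ?thesis using idx_less[OF s(1)] by linarith
qed

lemma tk_split:
  assumes "p \<le> K"
  shows "tk K = tk p @ map letter (filter taken [p..<K])"
proof -
  have "[0..<K] = [0..<p] @ [p..<K]" using assms upt_add_eq_append[of 0 p "K - p"] by simp
  then show ?thesis by (simp add: tk_def)
qed

text \<open>Every positive root lies in the positive part of an orbit, hence is an inversion of the
  reduced word \<open>tk K\<close>. The inverse of its product therefore negates all positive
  roots.\<close>

lemma tk_longest: "wp (tk K) = w\<^sub>0"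
proof -
  let ?g = "wp (tk K)"
  have neg: "nonpos (\<rho> (inv ?g) \<gamma>)" if \<gamma>: "\<gamma> \<in> roots" "nonneg \<gamma>" for \<gamma>
  proof -
    obtain s i where s: "s \<in> S" "i < num s" "\<gamma> = orb s i" using positive_root_orb[OF \<gamma>] by blast
    define p where "p = position s i"
    have p: "taken p" "letter p = s" "p div n = i" "p < K"
      using s position_less_K by (simp_all add: p_def taken_position)
    have "[p..<K] = p # [Suc p..<K]" using p by (simp add: upt_conv_Cons)
    then have split: "tk K = tk p @ s # map letter (filter taken [Suc p..<K])"
      using tk_split[of p] p by simp
    have "\<gamma> = foldr \<sigma> (tk p) (\<alpha> s)" using taken_root[OF p(1)] p s by simp
    then show ?thesis
      using reduced_inversion[of "tk p" s "map letter (filter taken [Suc p..<K])"]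
        tk_reduced[of K] tk_in_lists[of K] unfolding split[symmetric] by simp
  qed
  have "w\<^sub>0 = inv ?g"
    using neg simple_root_in_roots by (intro longest_eqI) (auto simp: tk_closed)
  then show ?thesis using longest_inv inv_inv[OF tk_closed] by metis
qed

text \<open>No copy of the letter is taken after \<open>q\<close>, so pulling its simple root back
  through the rest of \<open>tk K\<close> keeps coordinate 1 there and stays positive. Then
  \<open>w\<^sub>0\<close> makes it negative.\<close>

lemma skipped_root:
  assumes "\<not> taken q" "q \<le> K"
  shows "nonpos (foldr \<sigma> (tk q) (\<alpha> (letter q)))"
proof -
  let ?s = "letter q" and ?rest = "map letter (filter taken [q..<K])"
  let ?v = "foldr \<sigma> (rev ?rest) (\<alpha> ?s)"
  have notin: "?s \<notin> set ?rest"
  proof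
    assume "?s \<in> set ?rest"
    then obtain p where p: "q \<le> p" "taken p" "letter p = ?s" by auto
    then have "q div n \<le> p div n" by (simp add: div_le_mono)
    then show False using p assms by (simp add: taken_def)
  qed
  have rl: "?rest \<in> lists S" "rev ?rest \<in> lists S"
    using map_letter_in_lists[of "filter taken [q..<K]"]
      map_letter_in_lists[of "rev (filter taken [q..<K])"] by (simp_all add: rev_map)
  have "?v ?s = 1"
    using notin by (subst foldr_reflection_outside) (auto simp: simple_root_def)
  moreover have root: "?v \<in> roots" by (rule foldr_root[OF rl(2) letter_in])
  ultimately have "nonneg ?v" using root_nonnegI[of ?v ?s] by simp
  then have "nonpos (\<rho> w\<^sub>0 ?v)" using rep_longest_nonpos root by blast
  moreover have "\<rho> w\<^sub>0 ?v = foldr \<sigma> (tk K) ?v" using tk_longest rep_word[OF tk_in_lists] by metis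
  moreover have "\<dots> = foldr \<sigma> (tk q) (\<alpha> ?s)"
    using tk_split[OF assms(2)] foldr_rev_cancel[OF rl(2), of "\<alpha> ?s"] by simp
  ultimately show ?thesis by simp
qed

lemma periodic_subword_letter: "periodic_subword cs ps = map letter ps"
  by (simp add: periodic_subword_def letter_def)

lemma longest_positions_taken: "longest_positions W S cs (filter taken [0..<K])"
proof -
  have "map letter (filter taken [0..<K]) = tk K" by (simp add: tk_def)
  then show ?thesis
    using tk_reduced[of K] tk_longest tk_in_lists[of K]
    unfolding longest_positions_def reduced_word_def periodic_subword_letter
    by (simp add: sorted_wrt_filter)
qed

text \<open>Consider the first difference. A smaller competing position would be skipped, with
  common part \<open>tk b\<close>, and appending its letter would be reduced, against
  \<open>skipped_root\<close>.\<close>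

lemma longest_positions_first:
  assumes "longest_positions W S cs qs"
  shows "filter taken [0..<K] = qs \<or> (filter taken [0..<K], qs) \<in> lexord less_than"
proof (cases "filter taken [0..<K] = qs")
  case neq: False
  let ?ps = "filter taken [0..<K]"
  have q: "sorted_wrt (<) qs" "map letter qs \<in> lists S" "wp (map letter qs) = w\<^sub>0"
      "length qs = len w\<^sub>0"
    and p: "sorted_wrt (<) ?ps" "length ?ps = len w\<^sub>0"
    using assms longest_positions_taken
    unfolding longest_positions_def reduced_word_def periodic_subword_letter by auto
  obtain us a as b bs where ab: "a \<noteq> b" "?ps = us @ [a] @ as" "qs = us @ [b] @ bs"
    using same_length_different[OF neq] p q by auto
  have "\<not> b < a"
  proof
    assume "b < a"
    have "a \<in> set ?ps" using ab by simp
    then have bK: "b < K" using \<open>b < a\<close> by auto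
    have us: "\<forall>x\<in>set us. x < b" using q(1) ab by (simp add: sorted_wrt_append)
    have as: "\<forall>x\<in>set as. a < x" using p(1) ab by (simp add: sorted_wrt_append)
    have "\<not> taken b"
    proof
      assume "taken b"
      then have "b \<in> set ?ps" using bK by simp
      then show False using ab us as \<open>b < a\<close> by auto
    qed
    have "[0..<K] = [0..<b] @ [b..<K]" using bK upt_add_eq_append[of 0 b "K - b"] by simp
    moreover have "filter (\<lambda>x. x < b) (filter taken [0..<b]) = filter taken [0..<b]"
      by (rule filter_True) simp
    moreover have "filter (\<lambda>x. x < b) (filter taken [b..<K]) = []"
      by (rule filter_False) simp
    ultimately have "filter (\<lambda>x. x < b) ?ps = filter taken [0..<b]" by (simp only: filter_append append_Nil2)
    moreover have "filter (\<lambda>x. x < b) ?ps = us"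
      unfolding ab(2) using us as \<open>b < a\<close> by (auto simp: filter_empty_conv)
    ultimately have "us = filter taken [0..<b]" by simp
    then have tk: "map letter us = tk b" by (simp add: tk_def)
    have "map letter qs = (tk b @ [letter b]) @ map letter bs" using ab tk by simp
    then have "len (wp (tk b @ [letter b])) = length (tk b @ [letter b])"
      using reduced_prefix[of "tk b @ [letter b]" "map letter bs"] q by (metis length_map)
    then have "nonneg (foldr \<sigma> (tk b) (\<alpha> (letter b)))"
      using reduced_snoc[OF tk_in_lists letter_in] by simp
    then show False
      using skipped_root[OF \<open>\<not> taken b\<close>] bK root_sign[OF foldr_root[OF tk_in_lists letter_in]] by simp
  qed
  then have "(a, b) \<in> less_than" using ab(1) by simp
  then have "(?ps, qs) \<in> lexord less_than"
    unfolding ab(2,3) by (simp add: lexord_append_left_rightI)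
  then show ?thesis ..
qed simp

lemma longest_sorting_word_eq: "longest_sorting_word W S cs = tk K"
proof -
  let ?ps = "filter taken [0..<K]"
  have "(THE ps. longest_positions W S cs ps \<and>
      (\<forall>qs. longest_positions W S cs qs \<longrightarrow> ps = qs \<or> (ps, qs) \<in> lexord less_than)) = ?ps"
  proof (rule the_equality)
    fix ps assume ps: "longest_positions W S cs ps \<and>
      (\<forall>qs. longest_positions W S cs qs \<longrightarrow> ps = qs \<or> (ps, qs) \<in> lexord less_than)"
    show "ps = ?ps"
    proof (rule ccontr)
      assume "ps \<noteq> ?ps"
      then have "(ps, ?ps) \<in> lexord less_than" "(?ps, ps) \<in> lexord less_than"
        using ps longest_positions_taken longest_positions_first by metis+
      then show False
        using lexord_asymmetric[of less_than ps ?ps] by (simp add: asym_less_than)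
    qed
  qed (use longest_positions_taken longest_positions_first in blast)
  then show ?thesis
    unfolding longest_sorting_word_def by (simp add: periodic_subword_letter tk_def)
qed

lemma count_tk: "s \<in> S \<Longrightarrow> count_list (tk K) s = num s"
proof -
  assume s: "s \<in> S"
  have "count_list (tk K) s = length (filter (\<lambda>p. s = letter p) (filter taken [0..<K]))"
    by (simp add: tk_def count_list_eq_length_filter filter_map o_def)
  also have "\<dots> = card (set (filter (\<lambda>p. s = letter p) (filter taken [0..<K])))"
    by (rule distinct_card[symmetric]) simp
  also have "set (filter (\<lambda>p. s = letter p) (filter taken [0..<K])) = position s ` {..<num s}"
  proof (intro equalityI subsetI)
    fix p assume "p \<in> set (filter (\<lambda>p. s = letter p) (filter taken [0..<K]))"
    then show "p \<in> position s ` {..<num s}"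
      using position_letter[of p] by (auto simp: taken_def intro!: image_eqI[of _ _ "p div n"])
  next
    fix p assume "p \<in> position s ` {..<num s}"
    then show "p \<in> set (filter (\<lambda>p. s = letter p) (filter taken [0..<K]))"
      using s taken_position[OF s] position_less_K[OF s] by auto
  qed
  also have "card (position s ` {..<num s}) = num s"
    using s by (subst card_image) (auto intro!: inj_onI simp: position_def)
  finally show ?thesis .
qed

lemma length_tk: "length (tk K) = (\<Sum>s\<in>S. num s)"
proof -
  have "set (tk K) \<subseteq> S" using tk_in_lists[of K] by (auto simp only: in_lists_conv_set)
  then have "sum (count_list (tk K)) S = length (tk K)" by (intro sum_count_set) auto
  then show ?thesis by (simp add: count_tk)
qed

end

section \<open>Endpoints of the orbits and the order of \<open>c\<close>\<close>

context irreducible_coxeter_word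
begin

text \<open>Cut \<open>tk K\<close> at the first skipped copy of \<open>r\<close> and use that
  \<open>w\<^sub>0\<close> is an involution: the left part cancels against
  \<open>orb_factorization\<close>, and the right part fixes the vector, since its letters commute
  with the skipped ones and are orthogonal to \<open>\<alpha> r\<close>.\<close>

lemma rep_longest_orb_num:
  assumes r: "r \<in> S"
  shows "\<rho> w\<^sub>0 (orb r (num r)) = foldr \<sigma> (sk (position r (num r))) (\<alpha> r)"
proof -
  define p where "p = position r (num r)"
  have p: "letter p = r" "p div n = num r" "p < K" "\<not> taken p"
    using r position_less_K[OF r] taken_position[OF r] by (simp_all add: p_def)
  let ?rest = "map letter (filter taken [p..<K])" and ?v = "foldr \<sigma> (sk p) (\<alpha> r)"
  have rl: "?rest \<in> lists S" by (rule map_letter_in_lists)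
  have rc: "wp ?rest \<in> carrier W" using rl by (rule word_prod_closed)
  have fixed: "foldr \<sigma> ?rest ?v = ?v"
  proof (rule foldr_fixes)
    fix t assume "t \<in> set ?rest"
    then obtain q where q: "p \<le> q" "taken q" "t = letter q" by auto
    then have "p < q" using p by (cases "p = q") auto
    have t: "t \<in> S" using q by simp
    have "\<sigma> t ?v = \<rho> (t \<otimes> wp (sk p)) (\<alpha> r)"
      using t rep_word[OF sk_in_lists] sk_closed by (simp add: rep_mult rep_generator)
    also have "\<dots> = \<rho> (wp (sk p) \<otimes> t) (\<alpha> r)" using sk_commute[OF q(1,2)] q by simp
    also have "\<dots> = \<rho> (wp (sk p)) (\<sigma> t (\<alpha> r))"
      using t sk_closed by (simp add: rep_mult rep_generator)
    also have "\<sigma> t (\<alpha> r) = \<alpha> r"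
      using skipped_form_zero[OF \<open>p < q\<close> p(4) q(2)] p q form_commute[of "\<alpha> t" "\<alpha> r"]
      by (simp add: simple_reflection_def)
    finally show "\<sigma> t ?v = ?v" using rep_word[OF sk_in_lists] by simp
  qed
  have "w\<^sub>0 = wp (tk p) \<otimes> wp ?rest"
    using tk_longest tk_split[of p] p word_prod_append[OF tk_in_lists rl] by simp
  then have "inv w\<^sub>0 = inv (wp ?rest) \<otimes> inv (wp (tk p))"
    using tk_closed rc by (simp add: inv_mult_group)
  then have "\<rho> w\<^sub>0 (orb r (num r)) = \<rho> (inv (wp ?rest)) (\<rho> (inv (wp (tk p))) (orb r (num r)))"
    using tk_closed rc by (simp add: longest_inv rep_mult)
  also have "\<rho> (inv (wp (tk p))) (orb r (num r)) = ?v"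
    using orb_factorization[of p] p tk_closed by simp
  also have "\<rho> (inv (wp ?rest)) ?v = \<rho> (inv (wp ?rest)) (\<rho> (wp ?rest) ?v)"
    using fixed rep_word[OF rl] by simp
  also have "\<dots> = ?v" using rc by simp
  finally show ?thesis by (simp add: p_def)
qed

lemma position_inj: "s \<in> S \<Longrightarrow> t \<in> S \<Longrightarrow> position s i = position t j \<Longrightarrow> s = t"
  by (metis letter_position)

text \<open>The vector of \<open>rep_longest_orb_num\<close> has coordinate 1 at \<open>g r\<close>,
  so \<open>g r\<close> is \<open>r\<close> or a letter skipped earlier. The first skipped copy of
  \<open>g r\<close> is then no later than that of \<open>r\<close>.\<close>

lemma phi_eq_psi:
  assumes "r \<in> S"
  shows "phi r = \<psi> r"
proof -
  define f where "f = (\<lambda>r. position r (num r))"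
  define g where "g = (\<lambda>r. \<psi> (phi r))"
  have g: "g r \<in> S" if "r \<in> S" for r using that phi_closed by (simp add: g_def)
  have "inj_on g S"
    using phi_inj phi_closed unfolding g_def inj_on_def by (metis psi_involution)
  then have bij: "bij_betw g S S"
    using g by (simp add: bij_betw_def endo_inj_surj image_subsetI)
  have le: "f (g r) \<le> f r" if r: "r \<in> S" for r
  proof -
    have "\<rho> w\<^sub>0 (orb r (num r)) = (\<lambda>x. - \<rho> w\<^sub>0 (proj (phi r)) x)"
      using orb_num[OF r] by (simp add: rep_uminus)
    moreover have "\<rho> w\<^sub>0 (proj (phi r)) (g r) = - proj (phi r) (\<psi> (g r))"
      using root_outside[OF proj_root] r phi_closed g by (intro rep_longest) auto
    ultimately have "\<rho> w\<^sub>0 (orb r (num r)) (g r) = 1"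
      using r phi_closed by (simp add: g_def proj_same)
    then have "foldr \<sigma> (sk (f r)) (\<alpha> r) (g r) = 1"
      using rep_longest_orb_num[OF r] by (simp add: f_def)
    then have "g r = r \<or> g r \<in> set (sk (f r))"
      using foldr_reflection_outside[of "g r" "sk (f r)" "\<alpha> r"]
      by (auto simp: simple_root_def split: if_splits)
    then show ?thesis
    proof
      assume "g r \<in> set (sk (f r))"
      then obtain q where q: "q < f r" "\<not> taken q" "g r = letter q" by (auto simp: set_sk)
      then have "num (g r) * n \<le> q div n * n" by (simp add: taken_def)
      moreover have "f (g r) = num (g r) * n + q mod n" using q by (simp add: f_def position_def)
      ultimately have "f (g r) \<le> q" using div_mult_mod_eq[of q n] by linarith
      then show ?thesis using q by simp
    qed simp
  qed
  \<comment> \<open>A permutation that never increases \<open>f\<close> preserves its sum, hence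
    preserves \<open>f\<close> pointwise; and a position determines its letter.\<close>
  have "(\<Sum>r\<in>S. f (g r)) = (\<Sum>r\<in>S. f r)" using bij by (rule sum.reindex_bij_betw)
  then have "f (g r) = f r" using le assms by (intro sum_mono_inv[of "\<lambda>r. f (g r)" S f]) auto
  then have "g r = r" using position_inj g assms by (auto simp: f_def)
  then show ?thesis using assms phi_closed by (metis g_def psi_involution)
qed

lemma orb_num_psi: "s \<in> S \<Longrightarrow> orb s (num s) = (\<lambda>x. - proj (\<psi> s) x)"
  using orb_num phi_eq_psi by simp

lemma orb_num_add: "s \<in> S \<Longrightarrow> orb s (num s + i) = (\<lambda>x. - orb (\<psi> s) i x)"
  using rep_c_pow_orb[of i s "num s"] rep_c_pow_orb[of i "\<psi> s" 0]
  by (simp add: orb_num_psi rep_uminus add.commute)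

definition period :: "'a \<Rightarrow> nat" where
  "period s = num s + num (\<psi> s)"

lemma orb_period: "s \<in> S \<Longrightarrow> orb s (period s) = proj s"
  by (simp add: period_def orb_num_add orb_num_psi)

text \<open>From index \<open>num s\<close> on, the orbit is the negative of that of
  \<open>\<psi> s\<close> and stays negative for \<open>num (\<psi> s)\<close> steps.\<close>

lemma orb_nonneg_ge_period:
  assumes "s \<in> S" "num s \<le> i" "nonneg (orb s i)"
  shows "period s \<le> i"
proof (rule ccontr)
  assume "\<not> ?thesis"
  then have "i - num s < num (\<psi> s)" using assms by (simp add: period_def)
  then have "nonneg (orb (\<psi> s) (i - num s))" using orb_nonneg assms by simp
  then have "nonpos (orb s i)" using orb_num_add[of s "i - num s"] assms by simp
  then show False using root_sign[OF orb_root] assms by blast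
qed

text \<open>The transport of \<open>num_adjacent\<close>, continued to the exponent where the first
  argument is a \<open>proj\<close> again, so that the second argument comes out positive.\<close>

lemma period_adjacent:
  assumes "s \<in> S" "t \<in> S" "idx s < idx t" "B (\<alpha> s) (\<alpha> t) < 0"
  shows "period s = period t"
proof -
  note num = num_adjacent[OF assms]
  have "orb t (period s) s > 0"
    using euler_orb[of s "period s" 0 t 0] proj_before_pos[OF assms] assms
    by (simp add: orb_period euler_proj)
  then have "nonneg (orb t (period s))" using root_nonnegI orb_root assms by blast
  then have 1: "period t \<le> period s"
    using orb_nonneg_ge_period[of t "period s"] num assms by (simp add: period_def)
  have pos: "orb s (Suc (period t)) t > 0"
    using euler_orb[of t "period t" 0 s 1] rep_c_proj_ge[OF assms(1-3)] rep_c_orb[of s 0] assms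
    by (simp add: orb_period euler_proj)
  then have "nonneg (orb s (Suc (period t)))" using root_nonnegI orb_root assms by blast
  then have 2: "period s \<le> Suc (period t)"
    using orb_nonneg_ge_period[of s "Suc (period t)"] num assms by (simp add: period_def)
  \<comment> \<open>Equality would make the root in \<open>pos\<close> equal to
    \<open>proj s\<close>, whose coordinate at the later letter \<open>t\<close> is zero.\<close>
  have "period s \<noteq> Suc (period t)"
    using pos orb_period[OF assms(1)] proj_after[OF assms(1-3)] by auto
  then show ?thesis using 1 2 by simp
qed

lemma period_constant:
  assumes "s \<in> S" "t \<in> S"
  shows "period s = period t"
proof -
  have "(s, t) \<in> (coxeter_graph W S)\<^sup>*" using irreducible assms by (simp add: coxeter_irreducible_def)
  then show ?thesis
  proof induction
    case (step u v)
    then have uv: "u \<in> S" "v \<in> S" "u \<noteq> v" "coxeter_m W u v \<noteq> 2" by (auto simp: coxeter_graph_def)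
    then have neg: "B (\<alpha> u) (\<alpha> v) < 0" "B (\<alpha> v) (\<alpha> u) < 0"
      using form_simple_roots_neg[of u v] form_commute by auto
    have "idx u < idx v \<or> idx v < idx u" using idx_inj uv by (metis linorder_neqE_nat)
    then have "period u = period v" using period_adjacent[of u v] period_adjacent[of v u] uv neg by auto
    then show ?case using step by simp
  qed simp
qed

text \<open>All \<open>proj r\<close> are fixed since the period is constant, and by the triangular
  recursion so are the simple roots.\<close>

lemma c_pow_period:
  assumes "s \<in> S"
  shows "c [^] period s = \<one>"
proof (rule rep_faithful)
  fix t assume t: "t \<in> S"
  let ?w = "c [^] period s" and ?T = "{r \<in> S. idx r < idx t}"
  have w: "\<rho> ?w (proj r) = proj r" if "r \<in> S" for r
    using orb_period[OF that] period_constant[OF assms that] by (simp add: orb_def)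
  have "\<rho> ?w (\<alpha> t) x = \<alpha> t x" for x
  proof -
    have "(\<Sum>r\<in>?T. 2 * B (\<alpha> r) (\<alpha> t) * \<rho> ?w (proj r) x) =
        (\<Sum>r\<in>?T. 2 * B (\<alpha> r) (\<alpha> t) * proj r x)"
      using w by (intro sum.cong) auto
    then show ?thesis
      using rep_proj[of ?w t x] proj_expansion[OF t, of x] w[OF t] t by simp
  qed
  then show "\<rho> ?w (\<alpha> t) = \<alpha> t" by blast
qed simp

text \<open>A smaller exponent would bring \<open>proj s\<close> back early: not while the orbit is
  positive, by \<open>orb_neq_proj\<close>, nor while it is negative.\<close>

lemma ord_c:
  assumes "s \<in> S"
  shows "ord c = period s"
proof (rule ccontr)
  assume neq: "ord c \<noteq> period s"
  have pos: "period s > 0" using num_pos[OF assms] by (simp add: period_def)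
  have "ord c dvd period s" using c_pow_period[OF assms] by (simp add: pow_eq_id)
  then have less: "ord c < period s" using neq pos dvd_imp_le by (metis le_neq_implies_less)
  have o: "ord c > 0" using ord_ge_1[OF finite_carrier c_closed] by simp
  have eq: "orb s (ord c) = proj s" by (simp add: orb_def)
  then have "num s \<le> ord c" using orb_neq_proj[OF assms assms o] by fastforce
  then have "period s \<le> ord c"
    using orb_nonneg_ge_period[OF assms] eq proj_nonneg[OF assms] by simp
  then show False using less by simp
qed

lemma card_times_ord: "card S * ord c = 2 * len w\<^sub>0"
proof -
  have bij: "bij_betw \<psi> S S"
    by (rule bij_betw_byWitness[of _ \<psi>]) auto
  have "card S * ord c = (\<Sum>s\<in>S. ord c)" by simp
  also have "\<dots> = (\<Sum>s\<in>S. period s)" using ord_c by (intro sum.cong) auto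
  also have "\<dots> = (\<Sum>s\<in>S. num s) + (\<Sum>s\<in>S. num (\<psi> s))"
    unfolding period_def by (rule sum.distrib)
  also have "(\<Sum>s\<in>S. num (\<psi> s)) = (\<Sum>s\<in>S. num s)" using bij by (rule sum.reindex_bij_betw)
  also have "(\<Sum>s\<in>S. num s) = len w\<^sub>0" using length_tk tk_reduced[of K] tk_longest by simp
  finally show ?thesis by simp
qed

lemma coxeter_number_eq: "coxeter_number W S = ord c"
proof -
  have "ord d = ord c" if d: "coxeter_element W S d" for d
  proof -
    obtain ws where ws: "distinct ws" "set ws = S" "wp ws = d"
      using d by (auto simp: coxeter_element_def)
    \<comment> \<open>The results are instantiated at a second Coxeter element; both orders satisfy
      \<open>card_times_ord\<close> with the same right side.\<close>
    interpret d: irreducible_coxeter_word W S ws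
      using ws irreducible by unfold_locales
    have "card S * ord d = card S * ord c" using card_times_ord d.card_times_ord ws by simp
    moreover have "card S > 0"
      using irreducible by (simp add: coxeter_irreducible_def card_gt_0_iff)
    ultimately show ?thesis unfolding mult_cancel1 by linarith
  qed
  moreover have "coxeter_element W S c"
    unfolding coxeter_element_def using distinct_cs set_cs by blast
  ultimately show ?thesis
    unfolding coxeter_number_def by (intro the_equality) metis+
qed

lemma sorting_word_count:
  assumes "s \<in> S"
  shows "count_list (longest_sorting_word W S cs) s + count_list (longest_sorting_word W S cs) (\<psi> s) =
    coxeter_number W S"
  using assms ord_c[OF assms] by (simp add: longest_sorting_word_eq count_tk coxeter_number_eq period_def)

lemma sorting_word_letters: "set (longest_sorting_word W S cs) = S"
proof
  show "set (longest_sorting_word W S cs) \<subseteq> S"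
    unfolding longest_sorting_word_eq using tk_in_lists[of K] by (auto simp only: in_lists_conv_set)
  show "S \<subseteq> set (longest_sorting_word W S cs)"
    unfolding longest_sorting_word_eq using count_tk num_pos by (metis count_list_0_iff less_numeral_extra(3) subsetI)
qed

end

text \<open>The element \<open>d\<close> changes coordinate \<open>s\<close> of the preimage of
  \<open>proj s\<close> from nonpositive to 1, so every word for \<open>d\<close> contains
  \<open>s\<close>. A reduced one has at most \<open>card S\<close> letters, so each occurs
  once.\<close>

lemma (in finite_coxeter_system) reduced_coxeter_element_word:
  assumes "coxeter_element W S d" "reduced_word W S d cs"
  shows "distinct cs \<and> set cs = S"
proof -
  obtain ws where ws: "distinct ws" "set ws = S" "wp ws = d"
    using assms by (auto simp: coxeter_element_def)
  interpret d: coxeter_word W S ws using ws by unfold_locales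
  have cs: "cs \<in> lists S" "wp cs = d" "length cs = len d"
    using assms by (auto simp: reduced_word_def)
  have sub: "S \<subseteq> set cs"
  proof
    fix s assume s: "s \<in> S"
    let ?v = "\<rho> (inv d) (d.proj s)"
    have "d \<in> carrier W" using d.c_closed ws by simp
    then have root: "?v \<in> roots" using rep_root d.proj_root s by simp
    have "nonpos ?v" using d.rep_inv_c_proj[OF s] ws by simp
    then have "?v s \<le> 0" by (simp add: nonpos_def)
    moreover have "\<rho> d ?v s = 1" using d.proj_same[OF s] \<open>d \<in> carrier W\<close> by simp
    ultimately show "s \<in> set cs"
      using foldr_reflection_outside[of s cs ?v] rep_word[OF cs(1), of ?v] cs(2) by fastforce
  qed
  then have "set cs = S" using cs(1) by (auto simp only: in_lists_conv_set)
  moreover have "length cs \<le> card S"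
    using cs(3) length_word_ge[OF d.cs_in_lists] ws distinct_card[of ws] by simp
  ultimately show ?thesis
    using card_distinct[of cs] card_length[of cs] by simp
qed

section \<open>The rotation map\<close>

definition rank :: "nat set \<Rightarrow> nat \<Rightarrow> nat" where
  "rank X x = card {z \<in> X. z < x}"

lemma rank_strict_mono: "finite X \<Longrightarrow> x \<in> X \<Longrightarrow> x < y \<Longrightarrow> rank X x < rank X y"
  unfolding rank_def by (rule psubset_card_mono) auto

lemma rank_inj: "finite X \<Longrightarrow> x \<in> X \<Longrightarrow> y \<in> X \<Longrightarrow> rank X x = rank X y \<Longrightarrow> x = y"
  using rank_strict_mono[of X x y] rank_strict_mono[of X y x] by (cases x y rule: linorder_cases) auto

lemma rank_less_card: "finite X \<Longrightarrow> x \<in> X \<Longrightarrow> rank X x < card X"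
  unfolding rank_def by (rule psubset_card_mono) auto

lemma rank_next:
  assumes "finite X" "x \<in> X" "x < y" "\<And>z. z \<in> X \<Longrightarrow> x < z \<Longrightarrow> y \<le> z"
  shows "rank X y = Suc (rank X x)"
proof -
  have "{z \<in> X. z < y} = insert x {z \<in> X. z < x}"
    using assms by (auto simp: not_le[symmetric])
  then show ?thesis using assms by (simp add: rank_def)
qed

lemma rank_last:
  assumes "finite X" "x \<in> X" "\<And>z. z \<in> X \<Longrightarrow> \<not> x < z"
  shows "card X = Suc (rank X x)"
proof -
  have "X = insert x {z \<in> X. z < x}"
    using assms(2) assms(3)[THEN leI] by (auto simp: less_le)
  then have "card X = card (insert x {z \<in> X. z < x})" by simp
  then show ?thesis using assms by (simp add: rank_def)
qed

text \<open>Pure combinatorics of words: of the Coxeter group only the involution and the letter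
  counts remain. \<open>D\<close> will be \<open>2 * k + h\<close>.\<close>

locale rotation =
  fixes \<psi> :: "'a \<Rightarrow> 'a" and Q :: "'a list" and D :: nat
  assumes nonempty: "Q \<noteq> []"
    and psi_letters: "\<And>s. s \<in> set Q \<Longrightarrow> \<psi> s \<in> set Q"
    and psi_psi: "\<And>s. s \<in> set Q \<Longrightarrow> \<psi> (\<psi> s) = s"
    and counts: "\<And>s. s \<in> set Q \<Longrightarrow> count_list Q s + count_list Q (\<psi> s) = D"
begin

abbreviation "L \<equiv> length Q"
abbreviation "\<Theta> \<equiv> rotation_map \<psi> Q"

definition occ :: "'a \<Rightarrow> nat set" where
  "occ s = {i \<in> {1..L}. Q ! (i - 1) = s}"

lemma finite_occ [simp]: "finite (occ s)"
  by (simp add: occ_def)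

lemma card_occ: "card (occ s) = count_list Q s"
proof -
  have "occ s = Suc ` {i. i < L \<and> Q ! i = s}"
    by (auto simp: occ_def image_iff) (metis One_nat_def Suc_le_D Suc_le_lessD diff_Suc_1)
  then have "card (occ s) = card {i. i < L \<and> s = Q ! i}" by (simp add: card_image eq_commute)
  then show ?thesis by (simp add: count_list_eq_length_filter length_filter_conv_card)
qed

lemma occ_nonempty: "s \<in> set Q \<Longrightarrow> occ s \<noteq> {}"
  using card_occ[of s] by (auto simp: count_list_0_iff)

lemma count_pos: "s \<in> set Q \<Longrightarrow> count_list Q s > 0"
  by (metis count_list_0_iff gr0I)

text \<open>Letter and number of earlier occurrences are coordinates in which the rotation becomes
  \<open>step\<close>, which sees the word only through its letter counts.\<close>

definition label :: "nat \<Rightarrow> 'a \<times> nat" where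
  "label i = (Q ! (i - 1), rank (occ (Q ! (i - 1))) i)"

lemma occ_letter: "i \<in> {1..L} \<Longrightarrow> i \<in> occ (Q ! (i - 1))"
  by (simp add: occ_def)

lemma letter_in_set: "i \<in> {1..L} \<Longrightarrow> Q ! (i - 1) \<in> set Q"
  by auto

lemma label_inj: "i \<in> {1..L} \<Longrightarrow> j \<in> {1..L} \<Longrightarrow> label i = label j \<Longrightarrow> i = j"
  unfolding label_def prod.inject by (metis finite_occ occ_letter rank_inj)

definition step :: "'a \<times> nat \<Rightarrow> 'a \<times> nat" where
  "step = (\<lambda>(s, j). if Suc j < count_list Q s then (s, Suc j) else (\<psi> s, 0))"

lemma first_occurrence:
  assumes "s \<in> set Q"
  defines "j \<equiv> LEAST j. j \<in> {1..L} \<and> Q ! (j - 1) = s"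
  shows "j \<in> {1..L}" "label j = (s, 0)"
proof -
  obtain i where "i \<in> {1..L} \<and> Q ! (i - 1) = s"
    using occ_nonempty[OF assms(1)] by (auto simp: occ_def)
  then have j: "j \<in> {1..L} \<and> Q ! (j - 1) = s" unfolding j_def by (rule LeastI)
  have "{z \<in> occ s. z < j} = {}"
    unfolding j_def occ_def by (auto dest: not_less_Least)
  then show "j \<in> {1..L}" "label j = (s, 0)" using j by (auto simp: label_def rank_def)
qed

lemma rotation_step:
  assumes i: "i \<in> {1..L}"
  shows "\<Theta> i \<in> {1..L}" "label (\<Theta> i) = step (label i)"
proof -
  let ?s = "Q ! (i - 1)"
  have "\<Theta> i \<in> {1..L} \<and> label (\<Theta> i) = step (label i)"
  proof (cases "\<exists>j\<in>{1..L}. i < j \<and> Q ! (j - 1) = ?s")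
    case True
    define j where "j = (LEAST j. j \<in> {1..L} \<and> i < j \<and> Q ! (j - 1) = ?s)"
    have \<Theta>: "\<Theta> i = j" unfolding rotation_map_def j_def using i True by simp
    from True have "\<exists>j. j \<in> {1..L} \<and> i < j \<and> Q ! (j - 1) = ?s" by blast
    from LeastI_ex[OF this] have j: "j \<in> {1..L} \<and> i < j \<and> Q ! (j - 1) = ?s"
      unfolding j_def .
    have r: "rank (occ ?s) j = Suc (rank (occ ?s) i)"
    proof (rule rank_next)
      fix z assume "z \<in> occ ?s" "i < z"
      then have "z \<in> {1..L} \<and> i < z \<and> Q ! (z - 1) = ?s" by (simp add: occ_def)
      then show "j \<le> z" unfolding j_def by (rule Least_le)
    qed (use j occ_letter[OF i] in simp_all)
    moreover have "j \<in> occ ?s" using j by (simp add: occ_def)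
    then have "rank (occ ?s) j < count_list Q ?s" using rank_less_card[of "occ ?s" j] card_occ by simp
    ultimately show ?thesis using \<Theta> j by (simp add: label_def step_def)
  next
    case False
    have \<Theta>: "\<Theta> i = (LEAST j. j \<in> {1..L} \<and> Q ! (j - 1) = \<psi> ?s)"
      unfolding rotation_map_def by (simp only: i False not_True_eq_False if_False)
    have "card (occ ?s) = Suc (rank (occ ?s) i)"
      using False i by (intro rank_last) (auto simp: occ_def)
    then have "step (label i) = (\<psi> ?s, 0)" using card_occ[of ?s] by (simp add: label_def step_def)
    then show ?thesis
      unfolding \<Theta> using first_occurrence[OF psi_letters[OF letter_in_set[OF i]]] by (simp only:)
  qed
  then show "\<Theta> i \<in> {1..L}" "label (\<Theta> i) = step (label i)" by blast+
qed

lemma rotation_pow: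
  assumes "i \<in> {1..L}"
  shows "(\<Theta> ^^ m) i \<in> {1..L} \<and> label ((\<Theta> ^^ m) i) = (step ^^ m) (label i)"
proof (induction m)
  case (Suc m)
  then show ?case using rotation_step[of "(\<Theta> ^^ m) i"] by (simp del: atLeastAtMost_iff)
qed (use assms in simp)

lemma step_pow: "j + m < count_list Q s \<Longrightarrow> (step ^^ m) (s, j) = (s, j + m)"
  by (induction m) (auto simp: step_def)

lemma step_pow_count:
  assumes "s \<in> set Q"
  shows "(step ^^ count_list Q s) (s, 0) = (\<psi> s, 0)"
proof -
  obtain m where m: "count_list Q s = Suc m" using count_pos[OF assms] by (cases "count_list Q s") auto
  then have "(step ^^ m) (s, 0) = (s, m)" using step_pow[of 0 m s] by simp
  then show ?thesis using m by (simp add: step_def)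
qed

lemma step_pow_period: "s \<in> set Q \<Longrightarrow> (step ^^ D) (s, 0) = (s, 0)"
proof -
  assume s: "s \<in> set Q"
  have "D = count_list Q (\<psi> s) + count_list Q s" using counts[OF s] by simp
  then show ?thesis
    using step_pow_count[OF s] step_pow_count[OF psi_letters[OF s]] psi_psi[OF s]
    by (simp add: funpow_add)
qed

text \<open>If \<open>\<psi>\<close> fixes every letter, each cycle runs over the occurrences of one
  letter, half of \<open>D\<close> in number. Otherwise a moved letter has a cycle of length
  \<open>D\<close>, which is twice the cycle length at any fixed letter.\<close>

definition M :: nat where
  "M = (if \<forall>s\<in>set Q. \<psi> s = s then D div 2 else D)"

lemma step_pow_M: "s \<in> set Q \<Longrightarrow> (step ^^ M) (s, 0) = (s, 0)"
proof (cases "\<forall>s\<in>set Q. \<psi> s = s")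
  case True
  assume s: "s \<in> set Q"
  then have "M = count_list Q s" using counts[OF s] True by (simp add: M_def)
  then show ?thesis using step_pow_count[OF s] True s by simp
next
  case False
  assume s: "s \<in> set Q"
  have "M = D" using False by (auto simp: M_def)
  then show ?thesis using step_pow_period[OF s] by simp
qed

lemma M_pos: "M > 0"
proof -
  obtain s where s: "s \<in> set Q" using nonempty by (cases Q) auto
  then show ?thesis using counts[OF s] count_pos[OF s] count_pos[OF psi_letters[OF s]]
    by (auto simp: M_def)
qed

lemma rotation_pow_M: "\<Theta> ^^ M = id"
proof
  fix i
  show "(\<Theta> ^^ M) i = id i"
  proof (cases "i \<in> {1..L}")
    case True
    obtain s j where sj: "label i = (s, j)" by (cases "label i")
    have s: "s \<in> set Q" "j < count_list Q s"
      using sj True rank_less_card[OF finite_occ occ_letter[OF True]] card_occ letter_in_set[OF True]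
      by (auto simp: label_def)
    then have "(s, j) = (step ^^ j) (s, 0)" using step_pow[of 0 j s] by simp
    then have "(step ^^ M) (s, j) = (step ^^ (M + j)) (s, 0)" by (simp add: funpow_add)
    also have "\<dots> = (step ^^ (j + M)) (s, 0)" by (simp only: add.commute)
    finally have "(step ^^ M) (s, j) = (step ^^ j) ((step ^^ M) (s, 0))" by (simp add: funpow_add)
    then have "(step ^^ M) (s, j) = (s, j)" using step_pow_M s step_pow[of 0 j s] by simp
    then show ?thesis using rotation_pow[OF True, of M] label_inj[OF _ True] sj by simp
  next
    case False
    then have "\<Theta> i = i" by (simp add: rotation_map_def)
    then have "(\<Theta> ^^ m) i = i" for m by (induction m) auto
    then show ?thesis by simp
  qed
qed

text \<open>One cycle of length \<open>M\<close> suffices: that of any letter if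
  \<open>\<psi>\<close> fixes all of them, otherwise that of a moved letter.\<close>

lemma rotation_pow_neq:
  assumes "0 < m" "m < M"
  shows "\<Theta> ^^ m \<noteq> id"
proof -
  have "\<exists>s\<in>set Q. (step ^^ m) (s, 0) \<noteq> (s, 0)"
  proof (cases "\<forall>s\<in>set Q. \<psi> s = s")
    case True
    obtain s where s: "s \<in> set Q" using nonempty by (cases Q) auto
    then have "M = count_list Q s" using counts[OF s] True by (simp add: M_def)
    then show ?thesis using step_pow[of 0 m s] assms s by (intro bexI[of _ s]) auto
  next
    case False
    then obtain s where s: "s \<in> set Q" "\<psi> s \<noteq> s" by blast
    have D: "m < count_list Q s + count_list Q (\<psi> s)"
      using assms counts[OF s(1)] by (simp add: M_def split: if_splits)
    show ?thesis
    proof (cases "m < count_list Q s")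
      case True
      then show ?thesis using step_pow[of 0 m s] assms s by (intro bexI[of _ s]) auto
    next
      case False
      then have "m = (m - count_list Q s) + count_list Q s" by simp
      then have "(step ^^ m) (s, 0) = (step ^^ (m - count_list Q s)) (\<psi> s, 0)"
        using step_pow_count[OF s(1)] by (metis comp_apply funpow_add)
      also have "\<dots> = (\<psi> s, m - count_list Q s)"
        using step_pow[of 0 "m - count_list Q s" "\<psi> s"] D False by simp
      finally show ?thesis using s by (intro bexI[of _ s]) auto
    qed
  qed
  then obtain s where s: "s \<in> set Q" "(step ^^ m) (s, 0) \<noteq> (s, 0)" by blast
  then show ?thesis
    using rotation_pow[of "LEAST j. j \<in> {1..L} \<and> Q ! (j - 1) = s" m] first_occurrence[OF s(1)]
    by (metis id_apply)
qed

lemma rotation_permutes: "\<Theta> permutes {1..L}"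
proof -
  obtain m where m: "M = Suc m" using M_pos by (cases M) auto
  have "\<Theta> \<circ> \<Theta> ^^ m = id" "\<Theta> ^^ m \<circ> \<Theta> = id"
    using rotation_pow_M unfolding m by (simp, simp only: funpow_Suc_right)
  then have "bij \<Theta>" by (intro o_bij)
  moreover have "\<Theta> x = x" if "x \<notin> {1..L}" for x using that by (simp add: rotation_map_def)
  ultimately show ?thesis by (simp add: permutes_def bij_iff)
qed

lemma sym_group_pow: "x [^]\<^bsub>sym_group k\<^esub> (m::nat) = x ^^ m"
  by (induction m) (simp_all add: sym_group_def nat_pow_def funpow_swap1 fun_eq_iff)

theorem rotation_order:
  "\<Theta> \<in> carrier (sym_group L)" "group.ord (sym_group L) \<Theta> = M"
proof -
  interpret sym: group "sym_group L" by (rule sym_group_is_group)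
  show carrier: "\<Theta> \<in> carrier (sym_group L)" using rotation_permutes by (simp add: sym_group_def)
  have id: "\<one>\<^bsub>sym_group L\<^esub> = id" by (simp add: sym_group_def)
  have "sym.ord \<Theta> dvd M"
    using sym.pow_eq_id[OF carrier, of M] rotation_pow_M by (simp add: sym_group_pow id)
  then have "sym.ord \<Theta> > 0" "sym.ord \<Theta> \<le> M" using M_pos by (auto intro: dvd_imp_le dvd_pos_nat)
  moreover have "\<Theta> ^^ sym.ord \<Theta> = id"
    using sym.pow_ord_eq_1[OF carrier] by (simp add: sym_group_pow id)
  ultimately show "sym.ord \<Theta> = M" using rotation_pow_neq by (metis le_neq_implies_less)
qed

end

lemma count_list_distinct: "distinct xs \<Longrightarrow> count_list xs x = (if x \<in> set xs then 1 else 0)"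
  by (induction xs) auto

theorem theorem8p8:
  fixes W :: "('a, 'b) monoid_scheme" and S :: "'a set" and c :: 'a and cs :: "'a list"
    and k :: nat and Q :: "'a list" and \<Theta> :: "nat \<Rightarrow> nat"
  assumes "coxeter_system W S"
    and "finite (carrier W)"
    and "coxeter_irreducible W S"
    and "coxeter_element W S c"
    and "reduced_word W S c cs"
    and "Q = concat (replicate k cs) @ longest_sorting_word W S cs"
    and "\<Theta> = rotation_map (coxeter_psi W S) Q"
  shows "\<Theta> \<in> carrier (sym_group (length Q)) \<and>
    real (group.ord (sym_group (length Q)) \<Theta>) =
      (if acts_as_minus_one W S (longest_element W S)
       then real k + real (coxeter_number W S) / 2
       else 2 * real k + real (coxeter_number W S))"
proof -
  interpret coxeter_system W S by fact
  interpret finite_coxeter_system W S by unfold_locales fact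
  have cs: "distinct cs" "set cs = S" using reduced_coxeter_element_word assms by blast+
  interpret irreducible_coxeter_word W S cs
    using cs assms(3) by unfold_locales
  let ?h = "coxeter_number W S"
  have count_cs: "count_list cs s = 1" if "s \<in> S" for s
    using cs that by (simp add: count_list_distinct)
  have count_pow: "count_list (concat (replicate m cs)) s = m" if "s \<in> S" for s m
    by (induction m) (simp_all add: count_cs[OF that])
  have set_pow: "set (concat (replicate m cs)) \<subseteq> S" for m using cs by (induction m) auto
  have set_Q: "set Q = S" unfolding assms(6) using set_pow[of k] sorting_word_letters by auto
  have count_Q: "count_list Q s + count_list Q (\<psi> s) = 2 * k + ?h" if "s \<in> S" for s
    unfolding assms(6) using sorting_word_count[OF that] count_pow that psi_closed[OF that] by simp
  have "S \<noteq> {}" using assms(3) by (simp add: coxeter_irreducible_def)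
  then interpret rot: rotation \<psi> Q "2 * k + ?h"
    using set_Q count_Q by unfold_locales auto
  have "real rot.M = (if acts_as_minus_one W S w\<^sub>0 then real k + real ?h / 2 else 2 * real k + real ?h)"
  proof (cases "\<forall>s\<in>S. \<psi> s = s")
    case True
    obtain s where s: "s \<in> S" using \<open>S \<noteq> {}\<close> by blast
    \<comment> \<open>With \<open>\<psi> s = s\<close> the two summands of the count coincide, so
      the sum is even and \<open>div 2\<close> agrees with real division.\<close>
    then have "even (2 * k + ?h)" using count_Q[OF s] True by (metis dvd_triv_left mult_2)
    then have "real ((2 * k + ?h) div 2) = real k + real ?h / 2"
      by (simp add: real_of_nat_div add_divide_distrib)
    moreover have "acts_as_minus_one W S w\<^sub>0" using True acts_as_minus_one_iff by blast
    ultimately show ?thesis using True by (simp add: rot.M_def set_Q)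
  next
    case False
    then have "rot.M = 2 * k + ?h" unfolding rot.M_def set_Q by auto
    moreover have "\<not> acts_as_minus_one W S w\<^sub>0" using False acts_as_minus_one_iff by blast
    ultimately show ?thesis by simp
  qed
  then show ?thesis using rot.rotation_order unfolding assms(7) by simp
qed

end
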